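(* Assume $F$ is unknown to the bidder, satisfies Assumptions 1 and 2 (with constants $\Delta>0,c_f,C_f,\lambda$), and $F(b^*_{v,F})>0$. Then for any $\gamma>2$ and any $\epsilon>0$, the regret of UCBid1+ satisfies $R_T^{v,F}=O(T^{1/3+\epsilon})$ as $T\to\infty$.
   Context: Model: at rounds $t=1,\dots,T$ a bidder submits $B_t\in[0,1]$. $(V_t)$ i.i.d. in $[0,1]$ with mean $v$; $(M_t)$ i.i.d. in $[0,1]$ with CDF $F$, independent of $(V_t)$. If $M_t\le B_t$ the bidder wins, pays $B_t$, receives and observes $V_t$; otherwise she does not observe $V_t$. $M_t$ is observed at the end of every round. $U_{v,F}(b)=(v-b)F(b)$, $b^*_{v,F}=\max\{\operatorname{argmax}_{b\in[0,1]}U_{v,F}(b)\}$, $R_T^{v,F}=T\max_bU_{v,F}(b)-\sum_{t=1}^T\mathbb E[U_{v,F}(B_t)]$. Notation: $N_t=\sum_{s=1}^{t-1}\mathbf 1\{M_s\le B_s\}$, $\hat V_t=\frac1{N_t}\sum_{s=1}^{t-1}V_s\mathbf 1\{M_s\le B_s\}$, $\epsilon_t=\sqrt{\gamma\log(t-1)/(2N_t)}$, $\hat F_t(b)=\frac1{t-1}\sum_{s=1}^{t-1}\mathbf 1\{M_s<b\}$. Algorithm UCBid1+ (parameter $\gamma$): $B_1=1$ and for $t\ge2$, $B_t=\max\{\operatorname{argmax}_{b\in[0,1]}(\hat V_t+\epsilon_t-b)\hat F_t(b)\}$. Assumption 1: $F$ is continuously differentiable with density $f$ and strictly log-concave ($f/F$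 strictly decreasing on $(0,1)$). Assumption 2: $c_f<f(b)<C_f$ for $b\in[b^*_{v,F}-\Delta,b^*_{v,F}+\Delta]$, and $\phi_F:b\mapsto b+F(b)/f(b)$ has derivative at most $\lambda$ on $[b^*_{v,F},b^*_{v,F}+\Delta]$.
   Formalization: With F̂_t defined by M_s<b the argmax in UCBid1+ is usually empty; then B_t is taken as the largest point of [0,1] where the supremum is approached. F is C¹ on [0,1], c_f>0 is made explicit (automatic after shrinking Δ), and Assumption 2's intervals are intersected with [0,1]. *)

theory Defs
  imports "HOL-Probability.Probability" "HOL-Library.Landau_Symbols"
begin

text \<open>Sample path: \<open>\<omega> t = (V_t, M_t)\<close> for rounds \<open>t \<ge> 1\<close> (\<open>\<omega> 0\<close> is unused).\<close>

text \<open>"max argmax" of \<open>g\<close> on [0,1]. When the argmax set has a largest element,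
  this is exactly it. Otherwise (the sup is not attained, which happens for the
  left-continuous empirical CDF) we take the largest point at which the sup is
  approached, i.e. the largest maximiser of the upper-semicontinuous envelope.\<close>
definition top_argmax :: "(real \<Rightarrow> real) \<Rightarrow> real" where
  "top_argmax g =
     (let S = (SUP x\<in>{0..1}. g x);
          A = {b\<in>{0..1}. g b = S}
      in if (\<exists>b\<in>A. \<forall>b'\<in>A. b' \<le> b) then (THE b. b \<in> A \<and> (\<forall>b'\<in>A. b' \<le> b))
         else Sup {b\<in>{0..1}. \<forall>e>0. \<exists>x\<in>{0..1}. \<bar>x - b\<bar> < e \<and> g x > S - e})"

text \<open>Given the path \<omega> and the list \<open>bs = [B_1,...,B_{t-1}]\<close> of previous bids,
  the UCBid1+ bid \<open>B_t\<close> with \<open>t = length bs + 1\<close>.\<close>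
definition ucbid_next :: "real \<Rightarrow> (nat \<Rightarrow> real \<times> real) \<Rightarrow> real list \<Rightarrow> real" where
  "ucbid_next \<gamma> \<omega> bs =
     (let t = length bs + 1;
          won = (\<lambda>s. snd (\<omega> s) \<le> bs ! (s - 1));
          W = {s\<in>{1..<t}. won s};
          N = real (card W);
          Vhat = (\<Sum>s\<in>W. fst (\<omega> s)) / N;
          eps = sqrt (\<gamma> * ln (real t - 1) / (2 * N));
          Fhat = (\<lambda>b. real (card {s\<in>{1..<t}. snd (\<omega> s) < b}) / (real t - 1))
      in if t = 1 then 1 else top_argmax (\<lambda>b. (Vhat + eps - b) * Fhat b))"

fun ucbid_hist :: "real \<Rightarrow> (nat \<Rightarrow> real \<times> real) \<Rightarrow> nat \<Rightarrow> real list" where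
  "ucbid_hist \<gamma> \<omega> 0 = []"
| "ucbid_hist \<gamma> \<omega> (Suc n) = ucbid_hist \<gamma> \<omega> n @ [ucbid_next \<gamma> \<omega> (ucbid_hist \<gamma> \<omega> n)]"

definition ucbid :: "real \<Rightarrow> (nat \<Rightarrow> real \<times> real) \<Rightarrow> nat \<Rightarrow> real" where
  "ucbid \<gamma> \<omega> t = ucbid_hist \<gamma> \<omega> t ! (t - 1)"

definition path_space :: "real measure \<Rightarrow> real measure \<Rightarrow> (nat \<Rightarrow> real \<times> real) measure" where
  "path_space PV PM = PiM UNIV (\<lambda>_. PV \<Otimes>\<^sub>M PM)"

definition mean_val :: "real measure \<Rightarrow> real" where
  "mean_val PV = integral\<^sup>L PV (\<lambda>x. x)"

definition util :: "real \<Rightarrow> (real \<Rightarrow> real) \<Rightarrow> real \<Rightarrow> real" where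
  "util v F b = (v - b) * F b"

definition bstar :: "real \<Rightarrow> (real \<Rightarrow> real) \<Rightarrow> real" where
  "bstar v F = Sup {b\<in>{0..1}. util v F b = (SUP x\<in>{0..1}. util v F x)}"

definition regret :: "real measure \<Rightarrow> real measure \<Rightarrow> real \<Rightarrow> nat \<Rightarrow> real" where
  "regret PV PM \<gamma> T =
     real T * (SUP b\<in>{0..1}. util (mean_val PV) (cdf PM) b)
     - (\<Sum>t=1..T. integral\<^sup>L (path_space PV PM)
                     (\<lambda>\<omega>. util (mean_val PV) (cdf PM) (ucbid \<gamma> \<omega> t)))"

end

theory Submission
  imports Defs
begin

text \<open>
  Write \<open>x\<close> for the distance of the bid \<open>B\<close> of round \<open>n + 1\<close> to the optimal bid \<open>b*\<close>, and
  \<open>r = 2 ln n / n\<close>. Log-concavity of \<open>F\<close> gives a quadratic lower bound \<open>\<kappa> x\<^sup>2\<close> for the gap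
  \<open>U(b*) - U(B)\<close>. Conversely, \<open>B\<close> maximises the empirical objective, so the gap is at most the
  difference of the errors of that objective at \<open>B\<close> and at \<open>b*\<close>. The empirical mass of the interval
  between \<open>b*\<close> and \<open>B\<close> deviates from its mean by about \<open>sqrt (x r) + r\<close> (Chernoff's bound, uniformly
  over a grid), and the confidence width contributes \<open>x sqrt r\<close> as soon as the number of wins is linear
  in \<open>n\<close>. From \<open>\<kappa> x\<^sup>2 \<le> A (sqrt (x r) + r)\<close> one gets \<open>x = O(r powr (1/3))\<close>, hence a gap of order
  \<open>r powr (2/3)\<close>, which sums to \<open>T powr (1/3)\<close> up to logarithms. The values are only observed on
  wins; their deviations are controlled by an exponential supermartingale and a union bound over the
  number of wins.
\<close>

section \<open>The utility function\<close>

text \<open>Taken separately, the empirical errors at \<open>B\<close> and at \<open>b*\<close> are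
  of order \<open>sqrt r\<close>; that alone would give a gap of order \<open>sqrt r\<close> and
  regret of order \<open>sqrt T\<close>. The exponent 1/3 needs the increment of the error over an
  interval of mass \<open>O(x)\<close>: the bound then shrinks with \<open>x\<close> and becomes
  self-bounding. As \<open>B\<close> depends on the very sample it is tested against, increments
  must be controlled at every possible bid at once. The obstacle is a circularity: the width is
  small only after linearly many wins, wins require bids where \<open>F\<close> is not tiny, and
  bids depend on the width. An asymmetry breaks it: an index above \<open>v\<close> favours higher
  bids, so underbidding can be excluded without knowing the width. Exceptional events only need
  probability \<open>O(n powr (-2/3))\<close>, since the gap on them is bounded; the factor
  \<open>T powr \<epsilon>\<close> absorbs the logarithm.\<close>

locale log_concave_cdf =
  fixes F f :: "real \<Rightarrow> real" and v :: real
  assumes F_mono: "mono F" and F_nonneg: "0 \<le> F x" and F_le_1: "F x \<le> 1" and F_1: "F 1 = 1"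
    and f_cont: "continuous_on {0..1} f"
    and F_deriv: "x \<in> {0..1} \<Longrightarrow> (F has_real_derivative f x) (at x within {0..1})"
    and hazard: "strict_antimono_on {0<..<1} (\<lambda>b. f b / F b)"
    and v: "v \<in> {0..1}"
begin

abbreviation "U \<equiv> util v F"
abbreviation "bs \<equiv> bstar v F"

lemma F_cont: "continuous_on {0..1} F"
  using F_deriv DERIV_continuous_on by blast

lemma F_deriv_at: "x \<in> {0<..<1} \<Longrightarrow> (F has_real_derivative f x) (at x)"
  using F_deriv[of x] at_within_interior[of x "{0..1}"] by (auto simp: interior_atLeastAtMost_real)

lemma f_nonneg: assumes "x \<in> {0<..<1}" shows "0 \<le> f x"
  using mono_on_imp_deriv_nonneg[of "{0<..<1}" F "f x" x] F_mono F_deriv_at[OF assms] assms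
  by (auto simp: monotone_def mono_on_def interior_open)

text \<open>A strictly decreasing nonnegative function exceeds a later nonnegative value. As
  division by zero yields 0, positivity of the quotient also forces \<open>F x\<close> and
  \<open>f x\<close> to be positive.\<close>

lemma hazard_pos: assumes "x \<in> {0<..<1}" shows "0 < f x / F x"
proof -
  define y where "y = (x + 1) / 2"
  have y: "y \<in> {0<..<1}" "x < y" using assms by (auto simp: y_def)
  have "f y / F y < f x / F x"
    using hazard assms y by (auto simp: monotone_on_def)
  moreover have "0 \<le> f y / F y" using f_nonneg[OF y(1)] F_nonneg by simp
  ultimately show ?thesis by simp
qed

lemma F_pos: "x \<in> {0<..<1} \<Longrightarrow> 0 < F x"
  using hazard_pos[of x] F_nonneg[of x] f_nonneg[of x] by (auto simp: zero_less_divide_iff)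

lemma f_pos: "x \<in> {0<..<1} \<Longrightarrow> 0 < f x"
  using hazard_pos[of x] F_nonneg[of x] f_nonneg[of x] by (auto simp: zero_less_divide_iff)

lemma inverse_hazard_mono:
  assumes "x \<in> {0<..<1}" "y \<in> {0<..<1}" "x < y"
  shows "F x / f x < F y / f y"
proof -
  have "f y / F y < f x / F x" using hazard assms by (auto simp: monotone_on_def)
  then show ?thesis using F_pos[OF assms(1)] F_pos[OF assms(2)] f_pos[OF assms(1)] f_pos[OF assms(2)]
    by (auto simp: field_simps)
qed

text \<open>A bound for the continuous \<open>f\<close> on the compact interval serves as constant;
  it is raised to at least 1 so that \<open>sqrt K \<le> K\<close> is available later.\<close>

lemma F_lipschitz: "\<exists>K\<ge>1. \<forall>x y. 0 \<le> x \<longrightarrow> x \<le> y \<longrightarrow> y \<le> 1 \<longrightarrow> F y - F x \<le> K * (y - x)"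
proof -
  have "bounded (f ` {0..1})"
    using compact_continuous_image[OF f_cont] compact_imp_bounded by simp
  then obtain C where C: "\<And>x. x \<in> {0..1} \<Longrightarrow> \<bar>f x\<bar> \<le> C"
    by (auto simp: bounded_iff simp del: atLeastAtMost_iff)
  have "F y - F x \<le> max C 1 * (y - x)" if "0 \<le> x" "x \<le> y" "y \<le> 1" for x y
  proof (cases "x = y")
    case False
    then have "x < y" using that by simp
    moreover have "continuous_on {x..y} F" by (rule continuous_on_subset[OF F_cont]) (use that in auto)
    moreover have "(F has_derivative (*) (f z)) (at z)" if "x < z" "z < y" for z
      using F_deriv_at[of z] that \<open>0 \<le> x\<close> \<open>y \<le> 1\<close> by (simp add: has_field_derivative_def)
    ultimately obtain z where z: "x < z" "z < y" "F y - F x = f z * (y - x)"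
      using mvt[of x y F "\<lambda>z. (*) (f z)"] by blast
    then have "f z \<le> max C 1" using C[of z] that by auto
    then show ?thesis using z(3) that by (simp add: mult_right_mono)
  qed simp
  then show ?thesis by (intro exI[of _ "max C 1"]) auto
qed

lemma U_cont: "continuous_on {0..1} U"
  unfolding util_def by (intro continuous_intros F_cont)

lemma U_deriv: "x \<in> {0<..<1} \<Longrightarrow> (U has_real_derivative ((v - x) * f x - F x)) (at x)"
  unfolding util_def by (auto intro!: derivative_eq_intros F_deriv_at)

lemma
  shows bstar_mem: "bs \<in> {0..1}"
    and U_bstar: "U bs = (SUP x\<in>{0..1}. U x)"
    and U_le: "x \<in> {0..1} \<Longrightarrow> U x \<le> U bs"
proof -
  obtain m where m: "m \<in> {0..1}" "\<And>y. y \<in> {0..1} \<Longrightarrow> U y \<le> U m"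
    using continuous_attains_sup[OF _ _ U_cont] by (auto simp: compact_Icc)
  have S: "(SUP x\<in>{0..1}. U x) = U m"
    using m by (intro cSup_eq_maximum) auto
  let ?A = "{b\<in>{0..1}. U b = U m}"
  have "closed ?A"
    using continuous_closed_preimage_constant[OF U_cont] by (auto simp: Int_def)
  moreover have "?A \<noteq> {}" "bdd_above ?A" using m by (auto intro!: bdd_aboveI[of _ 1])
  ultimately have "Sup ?A \<in> ?A" by (intro closed_contains_Sup) auto
  then have *: "bs \<in> ?A" by (simp add: bstar_def S)
  then show "bs \<in> {0..1}" "U bs = (SUP x\<in>{0..1}. U x)" by (auto simp: S)
  show "x \<in> {0..1} \<Longrightarrow> U x \<le> U bs" using * m by auto
qed

lemma U_abs_le_1: "x \<in> {0..1} \<Longrightarrow> \<bar>U x\<bar> \<le> 1"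
  using v F_nonneg[of x] F_le_1[of x]
  by (auto simp: util_def abs_mult intro!: mult_le_one)

lemma bstar_le: assumes "0 < F bs" shows "bs \<le> v"
proof -
  have "0 \<le> U v" by (simp add: util_def)
  also have "U v \<le> U bs" using v by (intro U_le)
  finally show ?thesis using assms by (simp add: util_def zero_le_mult_iff)
qed

text \<open>If 1 were optimal, comparison with the bid \<open>v\<close> would force
  \<open>v = 1\<close> and optimal utility 0, but then the bid 1/2 earns more. Strictness matters
  because right limits of the empirical objective are compared only below 1.\<close>

lemma bstar_less_1: "bs < 1"
proof (rule ccontr)
  assume "\<not> bs < 1"
  then have b: "bs = 1" using bstar_mem by simp
  have "0 \<le> U v" by (simp add: util_def)
  also have "U v \<le> U bs" using v by (intro U_le)
  finally have "v = 1" using v b F_1 by (simp add: util_def)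
  then have "U (1/2) > U bs" using F_pos[of "1/2"] b by (simp add: util_def)
  then show False using U_le[of "1/2"] by simp
qed

text \<open>The first order condition is only available one-sidedly, since an atom of the law at 0
  allows \<open>bs = 0\<close> with negative slope; maximality of \<open>bs\<close> and monotonicity of \<open>F / f\<close> suffice.\<close>
lemma U_deriv_right:
  assumes "bs < x" "x < 1"
  shows "(v - x) * f x - F x \<le> - f x * (x - bs)"
proof -
  have x: "x \<in> {0<..<1}" using assms bstar_mem by auto
  have "v - bs \<le> F x / f x"
  proof (rule ccontr)
    assume "\<not> ?thesis"
    then have d: "0 < v - bs - F x / f x" (is "0 < ?d") by simp
    \<comment> \<open>Up to \<open>y\<close> the point moves away from \<open>bs\<close> by at most
      the defect \<open>?d\<close>, while \<open>F z / f z\<close> stays below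
      \<open>F x / f x\<close>; hence \<open>U\<close> has positive slope on all of
      \<open>(bs, y)\<close>.\<close>
    define y where "y = min x (bs + ?d)"
    have y: "bs < y" "y \<le> x" "y \<le> bs + ?d" using d assms by (auto simp: y_def)
    have "U bs < U y"
    proof (rule DERIV_pos_imp_increasing_open[OF y(1)])
      show "continuous_on {bs..y} U"
        by (rule continuous_on_subset[OF U_cont]) (use y x bstar_mem in auto)
      fix z assume z: "bs < z" "z < y"
      have z01: "z \<in> {0<..<1}" using z y x bstar_mem by auto
      have "F z / f z < F x / f x" using z y by (intro inverse_hazard_mono z01 x) auto
      then have "0 < v - z - F z / f z" using z y by linarith
      then have "0 < (v - z) * f z - F z" using f_pos[OF z01] by (simp add: field_simps)
      then show "\<exists>D. (U has_real_derivative D) (at z) \<and> 0 < D" using U_deriv[OF z01] by blast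
    qed
    moreover have "U y \<le> U bs" by (rule U_le) (use y x bstar_mem in auto)
    ultimately show False by simp
  qed
  then show ?thesis using f_pos[OF x] by (simp add: field_simps)
qed

lemma U_deriv_left:
  assumes "0 < x" "x < bs"
  shows "f x * (bs - x) \<le> (v - x) * f x - F x"
proof -
  have x: "x \<in> {0<..<1}" using assms bstar_mem by auto
  have "F x / f x \<le> v - bs"
  proof (rule ccontr)
    assume "\<not> ?thesis"
    then have d: "0 < F x / f x - (v - bs)" (is "0 < ?d") by simp
    define y where "y = max x (bs - ?d)"
    have y: "y < bs" "x \<le> y" "bs - ?d \<le> y" using d assms by (auto simp: y_def)
    have "U bs < U y"
    proof (rule DERIV_neg_imp_decreasing_open[OF y(1)])
      show "continuous_on {y..bs} U"
        by (rule continuous_on_subset[OF U_cont]) (use y x bstar_mem in auto)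
      fix z assume z: "y < z" "z < bs"
      have z01: "z \<in> {0<..<1}" using z y x bstar_mem by auto
      have "F x / f x < F z / f z" using z y by (intro inverse_hazard_mono z01 x) auto
      then have "v - z - F z / f z < 0" using z y by linarith
      then have "(v - z) * f z - F z < 0" using f_pos[OF z01] by (simp add: field_simps)
      then show "\<exists>D. (U has_real_derivative D) (at z) \<and> D < 0" using U_deriv[OF z01] by blast
    qed
    moreover have "U y \<le> U bs" by (rule U_le) (use y x bstar_mem in auto)
    ultimately show False by simp
  qed
  then show ?thesis using f_pos[OF x] by (simp add: field_simps)
qed

lemma U_decreasing_right:
  assumes "bs \<le> x" "x \<le> y" "y \<le> 1" shows "U y \<le> U x"
proof (rule DERIV_nonpos_imp_decreasing_open[OF assms(2)])
  show "continuous_on {x..y} U"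
    by (rule continuous_on_subset[OF U_cont]) (use assms bstar_mem in auto)
  fix z assume z: "x < z" "z < y"
  then have z01: "z \<in> {0<..<1}" using assms bstar_mem by auto
  have "0 \<le> f z * (z - bs)" using f_pos[OF z01] assms z by simp
  then have "(v - z) * f z - F z \<le> 0" using U_deriv_right[of z] z assms by simp
  then show "\<exists>D. (U has_real_derivative D) (at z) \<and> D \<le> 0" using U_deriv[OF z01] by blast
qed

lemma U_increasing_left:
  assumes "0 \<le> x" "x \<le> y" "y \<le> bs" shows "U x \<le> U y"
proof (rule DERIV_nonneg_imp_increasing_open[OF assms(2)])
  show "continuous_on {x..y} U"
    by (rule continuous_on_subset[OF U_cont]) (use assms bstar_mem in auto)
  fix z assume z: "x < z" "z < y"
  then have z01: "z \<in> {0<..<1}" using assms bstar_mem by auto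
  have "0 \<le> f z * (bs - z)" using f_pos[OF z01] assms z by simp
  then have "0 \<le> (v - z) * f z - F z" using U_deriv_left[of z] z assms by simp
  then show "\<exists>D. (U has_real_derivative D) (at z) \<and> 0 \<le> D" using U_deriv[OF z01] by blast
qed

text \<open>The slope of \<open>U\<close> towards \<open>bs\<close> is at least \<open>f z\<close>
  times the distance to \<open>bs\<close>, and \<open>f > c\<close> nearby; so \<open>bs\<close>
  remains a maximiser after adding the parabola \<open>c / 2 * (b - bs)^2\<close>.\<close>

lemma U_gap_near:
  assumes "0 < c" and c: "\<And>b. b \<in> {bs - d..bs + d} \<Longrightarrow> b \<in> {0..1} \<Longrightarrow> c < f b"
    and b: "b \<in> {0..1}" "\<bar>b - bs\<bar> \<le> d"
  shows "c / 2 * (b - bs)\<^sup>2 \<le> U bs - U b"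
proof -
  let ?G = "\<lambda>b. U b + c / 2 * (b - bs)\<^sup>2"
  have cont: "continuous_on {0..1} ?G" by (intro continuous_intros U_cont)
  have D: "(?G has_real_derivative ((v - z) * f z - F z + c * (z - bs))) (at z)" if "z \<in> {0<..<1}" for z
    by (auto intro!: derivative_eq_intros U_deriv that)
  have "?G b \<le> ?G bs"
  proof (cases "bs \<le> b")
    case True
    show ?thesis
    proof (rule DERIV_nonpos_imp_decreasing_open[OF True])
      show "continuous_on {bs..b} ?G"
        by (rule continuous_on_subset[OF cont]) (use b bstar_mem in auto)
      fix z assume z: "bs < z" "z < b"
      then have z01: "z \<in> {0<..<1}" using b bstar_mem by auto
      have "c * (z - bs) \<le> f z * (z - bs)"
        using c[of z] z z01 b by (intro mult_right_mono) auto
      moreover have "(v - z) * f z - F z \<le> - f z * (z - bs)" using U_deriv_right[of z] z z01 by simp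
      ultimately have "(v - z) * f z - F z + c * (z - bs) \<le> 0" by (simp only: minus_mult_left [symmetric])
      then show "\<exists>D. (?G has_real_derivative D) (at z) \<and> D \<le> 0" using D[OF z01] by blast
    qed
  next
    case False
    show ?thesis
    proof (rule DERIV_nonneg_imp_increasing_open[of b bs])
      show "b \<le> bs" using False by simp
      show "continuous_on {b..bs} ?G"
        by (rule continuous_on_subset[OF cont]) (use b bstar_mem in auto)
      fix z assume z: "b < z" "z < bs"
      then have z01: "z \<in> {0<..<1}" using b bstar_mem by auto
      have "c * (bs - z) \<le> f z * (bs - z)"
        using c[of z] z z01 b by (intro mult_right_mono) auto
      then have "0 \<le> (v - z) * f z - F z + c * (z - bs)"
        using U_deriv_left[of z] z z01 by (simp add: algebra_simps)
      then show "\<exists>D. (?G has_real_derivative D) (at z) \<and> 0 \<le> D" using D[OF z01] by blast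
    qed
  qed
  then show ?thesis by simp
qed

text \<open>Far from \<open>bs\<close>, unimodality keeps the gap above its value at distance
  \<open>e\<close>. Distances are at most 1, so the constant gap \<open>c / 2 * e^2\<close> is also
  a quadratic bound; the same factor works nearby because \<open>e \<le> 1\<close>.\<close>

lemma U_gap_quadratic:
  assumes "0 < c" "0 < d" and c: "\<And>b. b \<in> {bs - d..bs + d} \<Longrightarrow> b \<in> {0..1} \<Longrightarrow> c < f b"
  shows "\<exists>\<kappa>>0. \<forall>b\<in>{0..1}. \<kappa> * (b - bs)\<^sup>2 \<le> U bs - U b"
proof -
  define e where "e = min d 1"
  have e: "0 < e" "e \<le> d" "e \<le> 1" using assms(2) by (auto simp: e_def)
  have "c / 2 * e\<^sup>2 * (b - bs)\<^sup>2 \<le> U bs - U b" if b: "b \<in> {0..1}" for b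
  proof (cases "\<bar>b - bs\<bar> \<le> e")
    case True
    have "c / 2 * (b - bs)\<^sup>2 \<le> U bs - U b"
      using U_gap_near[OF assms(1) c b] True e by simp
    moreover have "c / 2 * e\<^sup>2 * (b - bs)\<^sup>2 \<le> c / 2 * 1 * (b - bs)\<^sup>2"
      using e assms(1) by (intro mult_right_mono mult_left_mono) (auto simp: power_le_one)
    ultimately show ?thesis by simp
  next
    case False
    have "(b - bs)\<^sup>2 \<le> 1" using b bstar_mem by (auto simp: abs_square_le_1)
    then have "c / 2 * e\<^sup>2 * (b - bs)\<^sup>2 \<le> c / 2 * e\<^sup>2 * 1" using assms(1) by (intro mult_left_mono) auto
    moreover have "c / 2 * e\<^sup>2 * 1 \<le> U bs - U b"
    proof (cases "bs \<le> b")
      case True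
      then have *: "bs + e \<le> b" using False by auto
      have "c / 2 * ((bs + e) - bs)\<^sup>2 \<le> U bs - U (bs + e)"
        by (rule U_gap_near[OF assms(1) c]) (use * e b bstar_mem in auto)
      moreover have "U b \<le> U (bs + e)" by (rule U_decreasing_right) (use * e b bstar_mem in auto)
      ultimately show ?thesis by simp
    next
      case F: False
      then have *: "b \<le> bs - e" using False by auto
      have "c / 2 * ((bs - e) - bs)\<^sup>2 \<le> U bs - U (bs - e)"
        by (rule U_gap_near[OF assms(1) c]) (use * e b bstar_mem in auto)
      moreover have "U b \<le> U (bs - e)" by (rule U_increasing_left) (use * e b bstar_mem in auto)
      ultimately show ?thesis by simp
    qed
    ultimately show ?thesis by simp
  qed
  moreover have "0 < c / 2 * e\<^sup>2" using assms(1) e by simp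
  ultimately show ?thesis by blast
qed

end

section \<open>The largest maximiser of the empirical objective\<close>

lemma largest_value_satisfying:
  fixes m :: "'i \<Rightarrow> real"
  assumes "finite I" "s0 \<in> I" "P (m s0)"
  obtains s where "s \<in> I" "P (m s)" "\<And>r. r \<in> I \<Longrightarrow> P (m r) \<Longrightarrow> m r \<le> m s"
proof -
  let ?X = "m ` {s\<in>I. P (m s)}"
  have "finite ?X" "?X \<noteq> {}" using assms by auto
  then have "Max ?X \<in> ?X" "\<And>y. y \<in> ?X \<Longrightarrow> y \<le> Max ?X" using Max_in Max_ge by auto
  then show thesis using that by auto
qed

text \<open>The objective \<open>g\<close> decreases between jumps of the left-continuous empirical distribution function,
  so its supremum is approached from the right of a jump; \<open>kp\<close> and \<open>gp\<close> are the right limits of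
  \<open>k\<close> and \<open>g\<close>. No assumption places the
  sample \<open>m\<close> in the unit interval: the explicit maximiser must be measurable on the whole path space,
  as the Bochner integral of a non-measurable function is 0.\<close>

locale empirical_objective =
  fixes I :: "'i set" and m :: "'i \<Rightarrow> real" and c :: real
  assumes fin: "finite I" and ne: "I \<noteq> {}"
begin

definition "k b = real (card {s\<in>I. m s < b})"
definition "kp b = real (card {s\<in>I. m s \<le> b})"
definition "g b = (c - b) * (k b / real (card I))"
definition "gp b = (c - b) * (kp b / real (card I))"
text \<open>A jump at 1 is excluded since its right limit is not approached from within [0,1];
  sample values below 0 are already counted in \<open>g 0\<close>.\<close>

definition "jump_in s \<longleftrightarrow> 0 \<le> m s \<and> m s < 1"
text \<open>The default \<open>g 0\<close> for irrelevant jumps keeps the index set fixed, which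
  makes this a finite maximum of measurable functions of the sample. The default 0 in
  \<open>top_point\<close> serves the same purpose.\<close>

definition "top_value = Max (insert (g 0) ((\<lambda>s. if jump_in s then gp (m s) else g 0) ` I))"
text \<open>Three regimes: the supremum is 0 and attained exactly from 0 up to the first sample
  value (capped at 1); it is attained at 0 only, which requires sample values below 0; or it is not
  attained, and the largest jump whose right limit reaches it is taken.\<close>

definition "top_point =
  (if k 0 = 0 \<and> top_value = 0 then min 1 (Min (m ` I))
   else if g 0 = top_value then 0
   else Max (insert 0 ((\<lambda>s. if jump_in s \<and> gp (m s) = top_value then m s else 0) ` I)))"

lemma card_pos: "0 < real (card I)"
  using fin ne by (simp add: card_gt_0_iff)

lemma kp_le_card: "kp b \<le> real (card I)"
  unfolding kp_def using fin by (auto intro: card_mono)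

lemma k_nonneg: "0 \<le> k b" and kp_nonneg: "0 \<le> kp b"
  by (auto simp: k_def kp_def)

lemma kp_ge_1: "s \<in> I \<Longrightarrow> 1 \<le> kp (m s)"
  using card_gt_0_iff[of "{r\<in>I. m r \<le> m s}"] fin by (auto simp: kp_def Suc_le_eq)

lemma top_value_ge: "g 0 \<le> top_value" "s \<in> I \<Longrightarrow> jump_in s \<Longrightarrow> gp (m s) \<le> top_value"
  unfolding top_value_def using fin by (auto intro!: Max_ge intro: image_eqI)

lemma top_value_cases: "top_value = g 0 \<or> (\<exists>s\<in>I. jump_in s \<and> gp (m s) = top_value)"
proof -
  have "top_value \<in> insert (g 0) ((\<lambda>s. if jump_in s then gp (m s) else g 0) ` I)"
    unfolding top_value_def using fin by (intro Max_in) auto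
  then show ?thesis by (auto split: if_splits)
qed

text \<open>Between jumps \<open>k\<close> is constant, so \<open>g\<close> is linear with slope
  \<open>- k / card I\<close>; the last jump before \<open>b\<close> (or 0, if there is none)
  determines its value.\<close>

lemma g_cases:
  assumes "b \<in> {0..1}"
  shows "(k b = k 0 \<and> g b = g 0 - b * (k 0 / real (card I))) \<or>
    (\<exists>s\<in>I. jump_in s \<and> m s < b \<and> k b = kp (m s) \<and> g b = gp (m s) - (b - m s) * (kp (m s) / real (card I)))"
proof (cases "\<exists>s\<in>I. 0 \<le> m s \<and> m s < b")
  case True
  then obtain s0 where "s0 \<in> I" "0 \<le> m s0 \<and> m s0 < b" by auto
  then obtain s where s: "s \<in> I" "0 \<le> m s \<and> m s < b" "\<And>r. r \<in> I \<Longrightarrow> 0 \<le> m r \<and> m r < b \<Longrightarrow> m r \<le> m s"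
    using largest_value_satisfying[of I s0 "\<lambda>x. 0 \<le> x \<and> x < b" m] fin by auto
  have "{r\<in>I. m r < b} = {r\<in>I. m r \<le> m s}" using s by force
  then have "k b = kp (m s)" by (simp add: k_def kp_def)
  then show ?thesis using s assms
    by (intro disjI2 bexI[of _ s]) (auto simp: jump_in_def g_def gp_def left_diff_distrib diff_divide_distrib)
next
  case False
  then have "{r\<in>I. m r < b} = {r\<in>I. m r < 0}" using assms by force
  then have "k b = k 0" by (simp add: k_def)
  then show ?thesis by (intro disjI1) (auto simp: g_def left_diff_distrib diff_divide_distrib)
qed

lemma g_le_top_value:
  assumes "b \<in> {0..1}" shows "g b \<le> top_value"
  using g_cases[OF assms]
proof (elim disjE bexE conjE)
  assume "g b = g 0 - b * (k 0 / real (card I))"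
  moreover have "0 \<le> b * (k 0 / real (card I))" using assms k_nonneg by simp
  ultimately show ?thesis using top_value_ge(1) by linarith
next
  fix s assume s: "s \<in> I" "jump_in s" "m s < b" "g b = gp (m s) - (b - m s) * (kp (m s) / real (card I))"
  moreover have "0 \<le> (b - m s) * (kp (m s) / real (card I))" using s(3) kp_nonneg by simp
  ultimately show ?thesis using top_value_ge(2)[of s] by linarith
qed

lemma g_less_top_value:
  assumes "b \<in> {0..1}" "0 < b" "0 < k b" shows "g b < top_value"
  using g_cases[OF assms(1)]
proof (elim disjE bexE conjE)
  assume *: "g b = g 0 - b * (k 0 / real (card I))" "k b = k 0"
  moreover have "0 < b * (k 0 / real (card I))" using * assms card_pos by simp
  ultimately show ?thesis using top_value_ge(1) by linarith
next
  fix s assume s: "s \<in> I" "jump_in s" "m s < b" "g b = gp (m s) - (b - m s) * (kp (m s) / real (card I))"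
  moreover have "0 < (b - m s) * (kp (m s) / real (card I))" using s kp_ge_1[of s] card_pos by simp
  ultimately show ?thesis using top_value_ge(2)[of s] by linarith
qed

lemma right_limit:
  assumes s: "s \<in> I" "jump_in s" and e: "0 < e"
  shows "\<exists>x\<in>{0..1}. \<bar>x - m s\<bar> < e \<and> gp (m s) - e < g x"
proof -
  let ?X = "insert 1 (m ` {r\<in>I. m s < m r})"
  \<comment> \<open>The next sample value, capped at 1: up to it, \<open>k\<close> equals
    \<open>kp (m s)\<close>.\<close>
  define u where "u = Min ?X"
  have u: "m s < u" "u \<le> 1" "\<And>r. r \<in> I \<Longrightarrow> m s < m r \<Longrightarrow> u \<le> m r"
    using fin s unfolding u_def by (auto simp: jump_in_def)
  define x where "x = m s + min (e / 2) (u - m s)"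
  have x: "m s < x" "x \<le> u" "x - m s < e" "x - m s \<le> e / 2" using u e by (auto simp: x_def min_def)
  have "{r\<in>I. m r < x} = {r\<in>I. m r \<le> m s}" using u x by force
  then have "k x = kp (m s)" by (simp add: k_def kp_def)
  then have "g x = gp (m s) - (x - m s) * (kp (m s) / real (card I))"
    by (simp add: g_def gp_def left_diff_distrib diff_divide_distrib)
  moreover have "(x - m s) * (kp (m s) / real (card I)) \<le> (x - m s) * 1"
    using x kp_le_card card_pos by (intro mult_left_mono) auto
  ultimately have "gp (m s) - (x - m s) \<le> g x" by simp
  then have "gp (m s) - e < g x" using x by linarith
  then show ?thesis using x u s by (intro bexI[of _ x]) (auto simp: jump_in_def)
qed

lemma SUP_g: "(SUP x\<in>{0..1}. g x) = top_value"
proof (rule cSup_eq_non_empty)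
  fix y assume y: "\<And>x. x \<in> g ` {0..1} \<Longrightarrow> x \<le> y"
  show "top_value \<le> y"
    using top_value_cases
  proof (elim disjE bexE conjE)
    assume "top_value = g 0" then show ?thesis using y[of "g 0"] by auto
  next
    fix s assume s: "s \<in> I" "jump_in s" "gp (m s) = top_value"
    show ?thesis
    proof (rule field_le_epsilon)
      fix e :: real assume "0 < e"
      then obtain x where "x \<in> {0..1}" "gp (m s) - e < g x" using right_limit[OF s(1,2)] by blast
      then show "top_value \<le> y + e" using y[of "g x"] s by auto
    qed
  qed
qed (use g_le_top_value in auto)

text \<open>Only finitely many right limits exist, so those below the top miss it by some
  \<open>d > 0\<close>. If \<open>g x\<close> is within \<open>e \<le> d\<close> of the top, the
  last jump before \<open>x\<close> is a top jump. Beyond it \<open>g\<close> falls with slope at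
  least \<open>1 / card I\<close>, so \<open>x\<close> lies within \<open>e * card I\<close> of it;
  the extra 1 in the bound accounts for the distance from \<open>x\<close> to
  \<open>b\<close>.\<close>

lemma Sup_approached:
  assumes "g 0 \<noteq> top_value"
  defines "Q \<equiv> m ` {s\<in>I. jump_in s \<and> gp (m s) = top_value}"
  shows "Sup {b\<in>{0..1}. \<forall>e>0. \<exists>x\<in>{0..1}. \<bar>x - b\<bar> < e \<and> g x > top_value - e} = Max Q"
proof (rule cSup_eq_maximum)
  have Q: "finite Q" "Q \<noteq> {}" using assms top_value_cases fin by auto
  then have "Max Q \<in> Q" by (rule Max_in)
  then obtain s where s: "s \<in> I" "jump_in s" "gp (m s) = top_value" "Max Q = m s" by (auto simp: Q_def)
  then show "Max Q \<in> {b\<in>{0..1}. \<forall>e>0. \<exists>x\<in>{0..1}. \<bar>x - b\<bar> < e \<and> g x > top_value - e}"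
    using right_limit[OF s(1,2)] by (auto simp: jump_in_def)
  fix b assume b: "b \<in> {b\<in>{0..1}. \<forall>e>0. \<exists>x\<in>{0..1}. \<bar>x - b\<bar> < e \<and> g x > top_value - e}"
  let ?V = "insert 1 ((\<lambda>y. top_value - y) ` {y\<in>insert (g 0) ((\<lambda>s. gp (m s)) ` I). y < top_value})"
  define d where "d = Min ?V"
  have d: "0 < d" unfolding d_def using fin by auto
  have gap: "y = top_value" if "y \<in> insert (g 0) ((\<lambda>s. gp (m s)) ` I)" "top_value - d < y" "y \<le> top_value" for y
  proof (rule ccontr)
    assume "y \<noteq> top_value"
    then have "d \<le> top_value - y" unfolding d_def using that fin by (intro Min_le) auto
    then show False using that by simp
  qed
  have n: "0 < real (card I) + 1" using card_pos by simp
  show "b \<le> Max Q"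
  proof (rule field_le_epsilon)
    fix e' :: real assume e': "0 < e'"
    define e where "e = min d (e' / (real (card I) + 1))"
    have e: "0 < e" "e \<le> d" using d e' n by (auto simp: e_def)
    have "e * (real (card I) + 1) \<le> e' / (real (card I) + 1) * (real (card I) + 1)"
      using n by (intro mult_right_mono) (auto simp: e_def)
    then have e3: "e * (real (card I) + 1) \<le> e'" using n by simp
    obtain x where x: "x \<in> {0..1}" "\<bar>x - b\<bar> < e" "g x > top_value - e" using b e(1) by auto
    show "b \<le> Max Q + e'"
      using g_cases[OF x(1)]
    proof (elim disjE bexE conjE)
      assume "g x = g 0 - x * (k 0 / real (card I))"
      moreover have "0 \<le> x * (k 0 / real (card I))" using x k_nonneg by simp
      ultimately have "top_value - d < g 0" using x e by linarith
      then show ?thesis using gap[of "g 0"] assms(1) top_value_ge(1) by simp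
    next
      fix s assume s: "s \<in> I" "jump_in s" "m s < x"
        and gx: "g x = gp (m s) - (x - m s) * (kp (m s) / real (card I))"
      have "0 \<le> (x - m s) * (kp (m s) / real (card I))" using s kp_nonneg by simp
      then have "top_value - d < gp (m s)" using x e gx by linarith
      then have top: "gp (m s) = top_value" using gap[of "gp (m s)"] s top_value_ge(2) by simp
      have "(x - m s) * (1 / real (card I)) \<le> (x - m s) * (kp (m s) / real (card I))"
        using s kp_ge_1[OF s(1)] by (intro mult_left_mono divide_right_mono) auto
      also have "\<dots> < e" using gx x top by linarith
      finally have "x - m s < e * real (card I)" using card_pos by (simp add: field_simps)
      then have "b < m s + e * (real (card I) + 1)" using x by (simp add: algebra_simps)
      moreover have "m s \<le> Max Q" using Q s top by (auto simp: Q_def)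
      ultimately show ?thesis using e3 by linarith
    qed
  qed
qed

lemma top_point_eq:
  assumes "\<not> (k 0 = 0 \<and> top_value = 0)" "g 0 \<noteq> top_value"
  shows "top_point = Max (m ` {s\<in>I. jump_in s \<and> gp (m s) = top_value})" (is "_ = Max ?Q")
proof -
  let ?R = "insert 0 ((\<lambda>s. if jump_in s \<and> gp (m s) = top_value then m s else 0) ` I)"
  have Q: "finite ?Q" "?Q \<noteq> {}" using assms top_value_cases fin by auto
  have "Max ?Q = Max ?R"
  proof (rule antisym)
    show "Max ?Q \<le> Max ?R" using Q fin by (intro Max_mono) auto
    have "0 \<le> q" if "q \<in> ?Q" for q using that by (auto simp: jump_in_def)
    then have "0 \<le> Max ?Q" using Max_in[OF Q] by blast
    then show "Max ?R \<le> Max ?Q" using Q fin by (auto simp: Max_ge)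
  qed
  then show ?thesis using assms by (auto simp: top_point_def)
qed

lemma top_argmax_g: "top_argmax g = top_point"
proof -
  let ?A = "{b\<in>{0..1}. g b = top_value}"
  let ?P = "\<lambda>b. b \<in> ?A \<and> (\<forall>b'\<in>?A. b' \<le> b)"
  \<comment> \<open>\<open>g\<close> lies strictly below the top at positive points with
    \<open>k b > 0\<close>; a positive maximiser thus has \<open>k b = 0\<close>, and the maximal
    value is 0.\<close>
  have k0: "k 0 = 0" "top_value = 0" if "b \<in> ?A" "0 < b" for b
  proof -
    have "k b = 0" using that g_less_top_value[of b] k_nonneg[of b] by force
    moreover have "k 0 \<le> k b" unfolding k_def using that fin by (auto intro!: card_mono)
    ultimately show "k 0 = 0" using k_nonneg[of 0] by simp
    show "top_value = 0" using that \<open>k b = 0\<close> by (simp add: g_def)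
  qed
  consider "k 0 = 0" "top_value = 0" | "\<not> (k 0 = 0 \<and> top_value = 0)" "g 0 = top_value"
    | "\<not> (k 0 = 0 \<and> top_value = 0)" "g 0 \<noteq> top_value" by blast
  then show ?thesis
  proof cases
    case 1
    define p where "p = min 1 (Min (m ` I))"
    have m: "0 \<le> m s" if "s \<in> I" for s
    proof (rule ccontr)
      assume "\<not> 0 \<le> m s"
      then have "s \<in> {s\<in>I. m s < 0}" using that by simp
      then show False using 1(1) fin by (auto simp: k_def card_eq_0_iff)
    qed
    have p: "p \<in> {0..1}" using m fin ne by (auto simp: p_def)
    have "\<not> m s < p" if "s \<in> I" for s
      using that fin by (auto simp: p_def not_less min.coboundedI2)
    then have "k p = 0" by (auto simp: k_def card_eq_0_iff)
    then have pA: "p \<in> ?A" using p 1 by (simp add: g_def)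
    have "b \<le> p" if b: "b \<in> ?A" for b
    proof (cases "0 < b")
      case True
      then have "k b = 0" using b g_less_top_value[of b] k_nonneg[of b] by force
      then have "\<And>s. s \<in> I \<Longrightarrow> b \<le> m s" using fin by (force simp: k_def card_eq_0_iff)
      then show ?thesis using b fin ne by (auto simp: p_def)
    qed (use p in auto)
    then have P: "?P p" using pA by blast
    then have "(THE b. ?P b) = p" by (intro the_equality) (auto intro: antisym)
    moreover have "\<exists>b\<in>?A. \<forall>b'\<in>?A. b' \<le> b" using P by blast
    ultimately have "top_argmax g = p" unfolding top_argmax_def SUP_g Let_def by (simp only: if_True)
    then show ?thesis using 1 by (simp add: p_def top_point_def)
  next
    case 2
    have A: "?A = {0}" using 2 k0 by force
    then have "?P 0" by auto
    then have "(THE b. ?P b) = 0" by (intro the_equality) (auto intro: antisym)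
    moreover have "\<exists>b\<in>?A. \<forall>b'\<in>?A. b' \<le> b" using \<open>?P 0\<close> by blast
    ultimately have "top_argmax g = 0" unfolding top_argmax_def SUP_g Let_def by (simp only: if_True)
    then show ?thesis using 2 by (auto simp: top_point_def)
  next
    case 3
    have "?A = {}"
    proof -
      have "b \<notin> ?A" for b using 3 k0[of b] by (cases "0 < b") auto
      then show ?thesis by blast
    qed
    then have "top_argmax g = Max (m ` {s\<in>I. jump_in s \<and> gp (m s) = top_value})"
      unfolding top_argmax_def SUP_g Let_def Sup_approached[OF 3(2)] by auto
    also have "\<dots> = top_point" using 3 by (intro top_point_eq [symmetric]) auto
    finally show ?thesis .
  qed
qed

lemma top_point_mem: "top_point \<in> {0..1}"
proof -
  have "Min (m ` I) \<ge> 0" if "k 0 = 0"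
  proof -
    have "0 \<le> m s" if "s \<in> I" for s
      using \<open>k 0 = 0\<close> that fin by (force simp: k_def card_eq_0_iff)
    then show ?thesis using fin ne by simp
  qed
  moreover have "Max (insert 0 ((\<lambda>s. if jump_in s \<and> gp (m s) = top_value then m s else 0) ` I)) \<in> {0..1}"
    using fin by (auto simp: Max_ge_iff Max_le_iff jump_in_def)
  ultimately show ?thesis by (auto simp: top_point_def)
qed

text \<open>The point \<open>b0\<close> makes the supremum positive while \<open>g 0 = 0\<close>, so
  the supremum is a right limit at a jump. This replaces the strict counts of the algorithm by the
  non-strict counts \<open>kp\<close>, whose means are values of the distribution function.\<close>

lemma top_point_optimal:
  assumes m: "\<And>s. s \<in> I \<Longrightarrow> 0 \<le> m s"
    and b0: "b0 < 1" "b0 < c" "0 < kp b0"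
  shows "top_point < 1" "top_point < c" "b < 1 \<Longrightarrow> gp b \<le> gp top_point"
proof -
  have k0: "k 0 = 0" using m by (force simp: k_def card_eq_0_iff)
  have g0: "g 0 = 0" by (simp add: g_def k0)
  have gp_le: "gp b \<le> top_value" if "b < 1" for b
  proof (cases "\<exists>s\<in>I. m s \<le> b")
    case True
    then obtain s0 where "s0 \<in> I" "m s0 \<le> b" by auto
    then obtain s where s: "s \<in> I" "m s \<le> b" "\<And>r. r \<in> I \<Longrightarrow> m r \<le> b \<Longrightarrow> m r \<le> m s"
      using largest_value_satisfying[of I s0 "\<lambda>x. x \<le> b" m] fin by auto
    have "{r\<in>I. m r \<le> b} = {r\<in>I. m r \<le> m s}" using s by force
    then have "kp b = kp (m s)" by (simp add: kp_def)
    then have "gp b \<le> gp (m s)" unfolding gp_def \<open>kp b = kp (m s)\<close> using s kp_nonneg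
      by (intro mult_right_mono) auto
    then show ?thesis using top_value_ge(2)[of s] s m that by (force simp: jump_in_def)
  next
    case False
    then have "kp b = 0" by (auto simp: kp_def card_eq_0_iff)
    then show ?thesis using top_value_ge(1) g0 by (simp add: gp_def)
  qed
  have "0 < gp b0" unfolding gp_def using b0 card_pos by simp
  then have top: "0 < top_value" using gp_le[OF b0(1)] by simp
  let ?Q = "m ` {s\<in>I. jump_in s \<and> gp (m s) = top_value}"
  have "top_point = Max ?Q" using top g0 by (intro top_point_eq) auto
  moreover have "Max ?Q \<in> ?Q" using top g0 top_value_cases fin by (intro Max_in) auto
  ultimately obtain s where s: "s \<in> I" "jump_in s" "gp (m s) = top_value" "top_point = m s" by auto
  show "top_point < 1" using s by (simp add: jump_in_def)
  show "b < 1 \<Longrightarrow> gp b \<le> gp top_point" using gp_le s by simp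
  have "0 < gp top_point" using s top by simp
  moreover have "gp top_point \<le> 0" if "c \<le> top_point"
    unfolding gp_def using that kp_nonneg[of top_point] by (intro mult_nonpos_nonneg) auto
  ultimately show "top_point < c" by linarith
qed

end

section \<open>The bids as random variables\<close>

definition wins :: "real \<Rightarrow> (nat \<Rightarrow> real \<times> real) \<Rightarrow> nat \<Rightarrow> nat set" where
  "wins \<gamma> \<omega> n = {s\<in>{1..n}. snd (\<omega> s) \<le> ucbid \<gamma> \<omega> s}"

definition width :: "real \<Rightarrow> (nat \<Rightarrow> real \<times> real) \<Rightarrow> nat \<Rightarrow> real" where
  "width \<gamma> \<omega> n = sqrt (\<gamma> * ln (real n) / (2 * real (card (wins \<gamma> \<omega> n))))"

definition ucb :: "real \<Rightarrow> (nat \<Rightarrow> real \<times> real) \<Rightarrow> nat \<Rightarrow> real" where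
  "ucb \<gamma> \<omega> n = (\<Sum>s\<in>wins \<gamma> \<omega> n. fst (\<omega> s)) / real (card (wins \<gamma> \<omega> n)) + width \<gamma> \<omega> n"

lemma length_ucbid_hist [simp]: "length (ucbid_hist \<gamma> \<omega> n) = n"
  by (induction n) auto

lemma ucbid_hist_nth: "i < n \<Longrightarrow> ucbid_hist \<gamma> \<omega> n ! i = ucbid \<gamma> \<omega> (Suc i)"
proof (induction n)
  case (Suc n)
  then show ?case by (cases "i = n") (auto simp: nth_append ucbid_def)
qed simp

lemma ucbid_1: "ucbid \<gamma> \<omega> (Suc 0) = 1"
  by (simp add: ucbid_def ucbid_next_def)

lemma ucbid_Suc:
  assumes "0 < n"
  shows "ucbid \<gamma> \<omega> (Suc n) = empirical_objective.top_point {1..n} (\<lambda>s. snd (\<omega> s)) (ucb \<gamma> \<omega> n)"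
proof -
  interpret empirical_objective "{1..n}" "\<lambda>s. snd (\<omega> s)" "ucb \<gamma> \<omega> n"
    by standard (use assms in auto)
  have W: "{s \<in> {1..<length (ucbid_hist \<gamma> \<omega> n) + 1}. snd (\<omega> s) \<le> ucbid_hist \<gamma> \<omega> n ! (s - 1)} = wins \<gamma> \<omega> n"
    by (auto simp: wins_def ucbid_hist_nth)
  have "ucbid \<gamma> \<omega> (Suc n) = ucbid_next \<gamma> \<omega> (ucbid_hist \<gamma> \<omega> n)"
    by (simp add: ucbid_def nth_append)
  also have "\<dots> = top_argmax (\<lambda>b. (ucb \<gamma> \<omega> n - b) * (real (card {s\<in>{1..n}. snd (\<omega> s) < b}) / real n))"
    unfolding ucbid_next_def Let_def W using assms
    by (auto simp: ucb_def width_def atLeastLessThanSuc_atLeastAtMost fun_eq_iff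
        intro!: arg_cong[of _ _ top_argmax])
  also have "(\<lambda>b. (ucb \<gamma> \<omega> n - b) * (real (card {s\<in>{1..n}. snd (\<omega> s) < b}) / real n)) = g"
    unfolding g_def k_def by simp
  finally show ?thesis unfolding top_argmax_g .
qed

lemma ucbid_mem: assumes "0 < t" shows "ucbid \<gamma> \<omega> t \<in> {0..1}"
proof (cases "t = 1")
  case False
  then obtain n where t: "t = Suc n" "0 < n" using assms by (cases t) auto
  interpret empirical_objective "{1..n}" "\<lambda>s. snd (\<omega> s)" "ucb \<gamma> \<omega> n"
    by standard (use t in auto)
  show ?thesis using top_point_mem t by (simp add: ucbid_Suc)
qed (simp add: ucbid_1)

text \<open>Predictability of the bids: the outcome of a round can be integrated out while the bid
  of that round stays frozen.\<close>

lemma ucbid_cong: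
  assumes "\<And>s. s \<in> {1..<t} \<Longrightarrow> \<omega> s = \<omega>' s" "0 < t"
  shows "ucbid \<gamma> \<omega> t = ucbid \<gamma> \<omega>' t"
proof -
  have "ucbid_hist \<gamma> \<omega> n = ucbid_hist \<gamma> \<omega>' n" if "n \<le> t" for n
    using that
  proof (induction n)
    case (Suc n)
    let ?h = "ucbid_hist \<gamma> \<omega>' n"
    have W: "{s\<in>{1..<length ?h + 1}. snd (\<omega> s) \<le> ?h ! (s - 1)} = {s\<in>{1..<length ?h + 1}. snd (\<omega>' s) \<le> ?h ! (s - 1)}"
      and F: "{s\<in>{1..<length ?h + 1}. snd (\<omega> s) < b} = {s\<in>{1..<length ?h + 1}. snd (\<omega>' s) < b}" for b
      using Suc.prems assms(1) by auto
    have S: "(\<Sum>s\<in>{s\<in>{1..<length ?h + 1}. snd (\<omega>' s) \<le> ?h ! (s - 1)}. fst (\<omega> s))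
      = (\<Sum>s\<in>{s\<in>{1..<length ?h + 1}. snd (\<omega>' s) \<le> ?h ! (s - 1)}. fst (\<omega>' s))"
      using Suc.prems assms(1) by (intro sum.cong) auto
    have "ucbid_next \<gamma> \<omega> ?h = ucbid_next \<gamma> \<omega>' ?h"
      unfolding ucbid_next_def Let_def W F S ..
    then show ?case using Suc by simp
  qed simp
  then show ?thesis by (simp add: ucbid_def)
qed

lemma real_card_eq_sum:
  "finite I \<Longrightarrow> real (card {s\<in>I. P s}) = (\<Sum>s\<in>I. if P s then 1 else 0)"
  by (simp add: sum.If_cases Int_def)

lemma measurable_top_point:
  assumes I: "finite I" "I \<noteq> {}"
    and [measurable]: "\<And>s. s \<in> I \<Longrightarrow> (\<lambda>\<omega>. m \<omega> s) \<in> borel_measurable P" "c \<in> borel_measurable P"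
  shows "(\<lambda>\<omega>. empirical_objective.top_point I (m \<omega>) (c \<omega>)) \<in> borel_measurable P"
proof -
  have loc: "empirical_objective I" using I by unfold_locales
  have ins: "Max (insert a (h ` I)) = max a (Max (h ` I))" for a :: real and h
    using I by (intro Max_insert) auto
  note defs = empirical_objective.k_def[OF loc] empirical_objective.kp_def[OF loc]
    empirical_objective.g_def[OF loc] empirical_objective.gp_def[OF loc]
    empirical_objective.jump_in_def[OF loc]
  have [measurable]: "(\<lambda>\<omega>. empirical_objective.k I (m \<omega>) 0) \<in> borel_measurable P"
    using I by (simp add: defs real_card_eq_sum)
  have [measurable]: "(\<lambda>\<omega>. empirical_objective.g I (m \<omega>) (c \<omega>) 0) \<in> borel_measurable P"
    unfolding empirical_objective.g_def[OF loc] by measurable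
  have [measurable]: "(\<lambda>\<omega>. empirical_objective.gp I (m \<omega>) (c \<omega>) (m \<omega> s)) \<in> borel_measurable P" if [simp]: "s \<in> I" for s
    unfolding defs using I by (simp add: real_card_eq_sum)
  have [measurable]: "Measurable.pred P (\<lambda>\<omega>. empirical_objective.jump_in (m \<omega>) s)" if [simp]: "s \<in> I" for s
    unfolding defs by measurable
  have [measurable]: "(\<lambda>\<omega>. empirical_objective.top_value I (m \<omega>) (c \<omega>)) \<in> borel_measurable P"
    unfolding empirical_objective.top_value_def[OF loc] ins
    by (intro borel_measurable_max borel_measurable_Max I measurable_If) measurable
  show ?thesis
    unfolding empirical_objective.top_point_def[OF loc] ins
    using I by (intro measurable_If borel_measurable_min borel_measurable_Min borel_measurable_max borel_measurable_Max I) measurable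
qed

lemma measurable_ucbid:
  assumes [measurable]: "\<And>s. (\<lambda>\<omega>. fst (\<omega> s)) \<in> borel_measurable P" "\<And>s. (\<lambda>\<omega>. snd (\<omega> s)) \<in> borel_measurable P"
    and "0 < t"
  shows "(\<lambda>\<omega>. ucbid \<gamma> \<omega> t) \<in> borel_measurable P"
  using \<open>0 < t\<close>
proof (induction t rule: less_induct)
  case (less t)
  show ?case
  proof (cases "t = 1")
    case False
    then obtain n where t: "t = Suc n" "0 < n" using less.prems by (cases t) auto
    have [measurable]: "(\<lambda>\<omega>. ucbid \<gamma> \<omega> s) \<in> borel_measurable P" if "s \<in> {1..n}" for s
      using less.IH[of s] that t by auto
    have W: "real (card (wins \<gamma> \<omega> n)) = (\<Sum>s\<in>{1..n}. if snd (\<omega> s) \<le> ucbid \<gamma> \<omega> s then 1 else 0)"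
      and S: "(\<Sum>s\<in>wins \<gamma> \<omega> n. fst (\<omega> s)) = (\<Sum>s\<in>{1..n}. if snd (\<omega> s) \<le> ucbid \<gamma> \<omega> s then fst (\<omega> s) else 0)" for \<omega>
      by (simp_all add: wins_def real_card_eq_sum sum.If_cases Int_def)
    have "(\<lambda>\<omega>. ucb \<gamma> \<omega> n) \<in> borel_measurable P"
      unfolding ucb_def width_def W S by measurable
    then show ?thesis unfolding t ucbid_Suc[OF t(2)]
      by (intro measurable_top_point) (use t in auto)
  qed (simp add: ucbid_1)
qed

section \<open>Concentration\<close>

text \<open>Gluing an independent copy after the first \<open>t\<close> coordinates preserves the
  product measure. \<open>X\<close> sees only the old path, and \<open>Y\<close> sees of the copy
  only its coordinate 0, which lands at position \<open>t\<close>; integrating the copy out leaves a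
  factor at most 1.\<close>

lemma (in sequence_space) nn_integral_predictable_step:
  assumes [measurable]: "X \<in> borel_measurable S" "Y \<in> borel_measurable S"
    and X: "\<And>\<omega> \<omega>'. (\<And>r. r < t \<Longrightarrow> \<omega> r = \<omega>' r) \<Longrightarrow> X \<omega> = X \<omega>'"
    and Y: "\<And>\<omega> \<omega>'. (\<And>r. r \<le> t \<Longrightarrow> \<omega> r = \<omega>' r) \<Longrightarrow> Y \<omega> = Y \<omega>'"
    and le1: "\<And>\<omega>. \<omega> \<in> space S \<Longrightarrow> (\<integral>\<^sup>+ z. Y (fun_upd \<omega> t (z)) \<partial>M) \<le> 1"
  shows "(\<integral>\<^sup>+ \<omega>. X \<omega> * Y \<omega> \<partial>S) \<le> (\<integral>\<^sup>+ \<omega>. X \<omega> \<partial>S)"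
proof -
  have "(\<integral>\<^sup>+ \<omega>. X \<omega> * Y \<omega> \<partial>S) = (\<integral>\<^sup>+ \<omega>. X \<omega> * Y \<omega> \<partial>distr (S \<Otimes>\<^sub>M S) S (\<lambda>(\<omega>, \<omega>'). comb_seq t \<omega> \<omega>'))"
    by (simp add: PiM_comb_seq)
  also have "\<dots> = (\<integral>\<^sup>+ p. (case p of (\<omega>, \<omega>') \<Rightarrow> X (comb_seq t \<omega> \<omega>') * Y (comb_seq t \<omega> \<omega>')) \<partial>(S \<Otimes>\<^sub>M S))"
    by (subst nn_integral_distr) (auto simp: split_beta')
  also have "\<dots> = (\<integral>\<^sup>+ \<omega>. \<integral>\<^sup>+ \<omega>'. X (comb_seq t \<omega> \<omega>') * Y (comb_seq t \<omega> \<omega>') \<partial>S \<partial>S)"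
    by (subst P.nn_integral_fst[symmetric]) auto
  also have "\<dots> = (\<integral>\<^sup>+ \<omega>. X \<omega> * (\<integral>\<^sup>+ \<omega>'. Y (comb_seq t \<omega> \<omega>') \<partial>S) \<partial>S)"
  proof (intro nn_integral_cong)
    fix \<omega> assume [measurable]: "\<omega> \<in> space S"
    have "X (comb_seq t \<omega> \<omega>') = X \<omega>" for \<omega>' by (rule X) (simp add: comb_seq_def)
    then show "(\<integral>\<^sup>+ \<omega>'. X (comb_seq t \<omega> \<omega>') * Y (comb_seq t \<omega> \<omega>') \<partial>S) = X \<omega> * (\<integral>\<^sup>+ \<omega>'. Y (comb_seq t \<omega> \<omega>') \<partial>S)"
      by (simp add: nn_integral_cmult)
  qed
  also have "\<dots> \<le> (\<integral>\<^sup>+ \<omega>. X \<omega> * 1 \<partial>S)"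
  proof (intro nn_integral_mono mult_left_mono)
    fix \<omega> assume \<omega>[measurable]: "\<omega> \<in> space S"
    have [measurable]: "(\<lambda>z. fun_upd \<omega> t z) \<in> measurable M S"
      by (rule measurable_fun_upd[where J=UNIV]) auto
    have "(\<integral>\<^sup>+ \<omega>'. Y (comb_seq t \<omega> \<omega>') \<partial>S) = (\<integral>\<^sup>+ \<omega>'. Y (fun_upd \<omega> t (\<omega>' 0)) \<partial>S)"
      by (intro nn_integral_cong Y) (auto simp: comb_seq_def)
    also have "\<dots> = (\<integral>\<^sup>+ z. Y (fun_upd \<omega> t (z)) \<partial>distr S M (\<lambda>\<omega>'. \<omega>' 0))"
      by (subst nn_integral_distr) auto
    also have "\<dots> = (\<integral>\<^sup>+ z. Y (fun_upd \<omega> t (z)) \<partial>M)"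
      by (subst PiM_component) auto
    finally show "(\<integral>\<^sup>+ \<omega>'. Y (comb_seq t \<omega> \<omega>') \<partial>S) \<le> 1" using le1[OF \<omega>] by simp
  qed auto
  finally show ?thesis by simp
qed

text \<open>The exponential of the sum has expectation at most 1 by peeling off one round at a time;
  Markov's inequality gives the tail. Adaptedness suffices, so the increments may depend on past
  bids.\<close>

lemma (in sequence_space) prob_exp_supermartingale:
  fixes y :: "nat \<Rightarrow> (nat \<Rightarrow> 'a) \<Rightarrow> real"
  assumes y: "\<And>s. s \<in> {1..n} \<Longrightarrow> y s \<in> borel_measurable S"
    and cong: "\<And>s \<omega> \<omega>'. s \<in> {1..n} \<Longrightarrow> (\<And>r. r \<le> s \<Longrightarrow> \<omega> r = \<omega>' r) \<Longrightarrow> y s \<omega> = y s \<omega>'"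
    and le1: "\<And>s \<omega>. s \<in> {1..n} \<Longrightarrow> \<omega> \<in> space S \<Longrightarrow> (\<integral>\<^sup>+ z. exp (y s (fun_upd \<omega> s (z))) \<partial>M) \<le> 1"
  shows "measure S {\<omega>\<in>space S. L \<le> (\<Sum>s\<in>{1..n}. y s \<omega>)} \<le> exp (- L)"
proof -
  have int: "(\<integral>\<^sup>+ \<omega>. exp (\<Sum>s\<in>{1..k}. y s \<omega>) \<partial>S) \<le> 1" if "k \<le> n" for k
    using that
  proof (induction k)
    case 0
    then show ?case by (simp add: P.emeasure_space_1)
  next
    case (Suc k)
    have [measurable]: "y s \<in> borel_measurable S" if "s \<in> {1..Suc k}" for s
      using y Suc.prems that by auto
    have "(\<integral>\<^sup>+ \<omega>. exp (\<Sum>s\<in>{1..Suc k}. y s \<omega>) \<partial>S)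
      = (\<integral>\<^sup>+ \<omega>. ennreal (exp (\<Sum>s\<in>{1..k}. y s \<omega>)) * ennreal (exp (y (Suc k) \<omega>)) \<partial>S)"
      by (simp add: exp_add ennreal_mult)
    also have "\<dots> \<le> (\<integral>\<^sup>+ \<omega>. exp (\<Sum>s\<in>{1..k}. y s \<omega>) \<partial>S)"
    proof (rule nn_integral_predictable_step[where t="Suc k"])
      show "(\<lambda>\<omega>. ennreal (exp (\<Sum>s\<in>{1..k}. y s \<omega>))) \<in> borel_measurable S" by measurable
      show "(\<lambda>\<omega>. ennreal (exp (y (Suc k) \<omega>))) \<in> borel_measurable S" by measurable
      fix \<omega> \<omega>' :: "nat \<Rightarrow> 'a"
      show "ennreal (exp (\<Sum>s\<in>{1..k}. y s \<omega>)) = ennreal (exp (\<Sum>s\<in>{1..k}. y s \<omega>'))"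
        if "\<And>r. r < Suc k \<Longrightarrow> \<omega> r = \<omega>' r"
        using that Suc.prems by (intro arg_cong[where f="\<lambda>x. ennreal (exp x)"] sum.cong cong) auto
      show "ennreal (exp (y (Suc k) \<omega>)) = ennreal (exp (y (Suc k) \<omega>'))"
        if "\<And>r. r \<le> Suc k \<Longrightarrow> \<omega> r = \<omega>' r"
        using that Suc.prems by (intro arg_cong[where f="\<lambda>x. ennreal (exp x)"] cong) auto
    qed (use le1 Suc.prems in auto)
    also have "\<dots> \<le> 1" using Suc by simp
    finally show ?case .
  qed
  let ?E = "{\<omega>\<in>space S. L \<le> (\<Sum>s\<in>{1..n}. y s \<omega>)}"
  note y[measurable]
  have [measurable]: "?E \<in> sets S" by measurable
  have "ennreal (exp L) * emeasure S ?E = (\<integral>\<^sup>+ \<omega>. ennreal (exp L) * indicator ?E \<omega> \<partial>S)"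
    by (simp add: nn_integral_cmult_indicator)
  also have "\<dots> \<le> (\<integral>\<^sup>+ \<omega>. exp (\<Sum>s\<in>{1..n}. y s \<omega>) \<partial>S)"
    by (intro nn_integral_mono) (auto simp: indicator_def intro!: ennreal_leI)
  also have "\<dots> \<le> 1" by (rule int) simp
  finally have "ennreal (exp L * measure S ?E) \<le> ennreal 1"
    by (simp add: P.emeasure_eq_measure ennreal_mult)
  then have "exp L * measure S ?E \<le> 1" by (subst (asm) ennreal_le_iff) auto
  then show ?thesis by (simp add: exp_minus field_simps)
qed

lemma exp_le_quadratic:
  fixes x :: real assumes "\<bar>x\<bar> \<le> 1" shows "exp x \<le> 1 + x + x\<^sup>2"
proof (cases "0 \<le> x")
  case True then show ?thesis using exp_bound[of x] assms by simp
next
  case False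
  define u where "u = - x"
  have u: "0 \<le> u" "u \<le> 1" using False assms by (auto simp: u_def)
  \<comment> \<open>The quadratic Taylor lower bound for \<open>exp u\<close>, multiplied by the
    claimed majorant of \<open>exp (- u)\<close>, still exceeds 1.\<close>
  have "1 \<le> 1 + u\<^sup>2 / 2 * (1 + u + u\<^sup>2)" using u by simp
  also have "\<dots> = (1 - u + u\<^sup>2) * (1 + u + u\<^sup>2 / 2)" by (simp add: field_simps power2_eq_square)
  also have "\<dots> \<le> (1 - u + u\<^sup>2) * exp u"
    using u exp_lower_Taylor_quadratic[of u] by (intro mult_left_mono) auto
  finally have "exp (- u) \<le> 1 - u + u\<^sup>2" by (simp add: exp_minus field_simps)
  then show ?thesis by (simp add: u_def)
qed

section \<open>Tail bounds for counts and for the values observed on wins\<close>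

locale auction = V: real_distribution PV + M: real_distribution PM for PV PM :: "real measure" +
  fixes \<gamma> :: real
  assumes V01: "measure PV {0..1} = 1" and M01: "measure PM {0..1} = 1"
    and gamma: "\<gamma> > 2"
begin

abbreviation "Q \<equiv> PV \<Otimes>\<^sub>M PM"
abbreviation "\<Omega> \<equiv> path_space PV PM"
abbreviation "v \<equiv> mean_val PV"
abbreviation "F \<equiv> cdf PM"

sublocale Q: pair_prob_space PV PM ..

sublocale seq: sequence_space Q
  by unfold_locales

sublocale P: prob_space \<Omega>
  unfolding path_space_def by unfold_locales

lemma path_space_eq: "\<Omega> = seq.S"
  by (simp add: path_space_def)

lemma space_path [simp]: "space \<Omega> = UNIV"
  by (simp add: path_space_def space_PiM space_pair_measure)

lemma measurable_fst [measurable]: "(\<lambda>\<omega>. fst (\<omega> s)) \<in> borel_measurable \<Omega>"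
  unfolding path_space_def by measurable

lemma measurable_snd [measurable]: "(\<lambda>\<omega>. snd (\<omega> s)) \<in> borel_measurable \<Omega>"
  unfolding path_space_def by measurable

lemma measurable_bid [measurable]: "0 < t \<Longrightarrow> (\<lambda>\<omega>. ucbid \<gamma> \<omega> t) \<in> borel_measurable \<Omega>"
  by (rule measurable_ucbid) auto

lemma AE_V: "AE x in PV. x \<in> {0..1}"
  using V.prob_eq_1[of "{0..1}"] V01 by simp

lemma AE_M: "AE x in PM. x \<in> {0..1}"
  using M.prob_eq_1[of "{0..1}"] M01 by simp

lemma integrable_V: "integrable PV (\<lambda>x. x)"
  by (rule V.integrable_const_bound[where B=1]) (use AE_V in auto)

lemma v_mem: "v \<in> {0..1}"
proof -
  have "0 \<le> v" unfolding mean_val_def using AE_V by (intro integral_nonneg_AE) auto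
  moreover have "v \<le> 1" unfolding mean_val_def using AE_V
    by (intro V.integral_le_const integrable_V) auto
  ultimately show ?thesis by simp
qed

lemma AE_path_M: "AE \<omega> in \<Omega>. \<forall>s. snd (\<omega> s) \<in> {0..1}"
proof -
  have "AE z in Q. snd z \<in> {0..1}"
  proof (rule Q.AE_pair_measure)
    show "{z \<in> space Q. snd z \<in> {0..1}} \<in> sets Q" by measurable
  qed (use AE_M in auto)
  then have "AE \<omega> in \<Omega>. snd (\<omega> s) \<in> {0..1}" for s
    unfolding path_space_def
    by (intro AE_PiM_component[where P="\<lambda>z. snd z \<in> {0..1}"]) (auto intro: Q.P.prob_space_axioms)
  then show ?thesis by (simp add: AE_all_countable)
qed

lemma hoeffding_V:
  assumes "\<sigma> = 1 \<or> \<sigma> = -1" "0 < l"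
  shows "(\<integral>\<^sup>+ x. exp (l * (\<sigma> * (x - v))) \<partial>PV) \<le> ennreal (exp (l\<^sup>2 / 8))"
proof -
  \<comment> \<open>Lower end of the range of \<open>\<sigma> * (x - v)\<close>, an interval of
    length 1 for either sign. The sign is kept apart from \<open>l\<close> because Hoeffding's lemma
    is applied with positive \<open>l\<close>.\<close>
  define a where "a = (if \<sigma> = 1 then - v else v - 1)"
  interpret W: interval_bounded_random_variable PV "\<lambda>x. \<sigma> * (x - v)" a "a + 1"
  proof
    show "AE x in PV. \<sigma> * (x - v) \<in> {a..a + 1}"
      using AE_V by eventually_elim (use assms in \<open>auto simp: a_def\<close>)
  qed simp
  have "V.expectation (\<lambda>x. \<sigma> * (x - v)) = 0"
    using integrable_V by (simp add: mean_val_def V.prob_space[unfolded V.space_eq_univ])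
  from W.Hoeffdings_lemma_nn_integral_0[OF assms(2) this] show ?thesis by simp
qed

text \<open>For an indicator of mean \<open>p\<close> the centred exponential moment is at most
  \<open>exp (p * (exp l - 1 - l))\<close>, hence at most \<open>exp (p * l^2)\<close> for
  \<open>\<bar>l\<bar> \<le> 1\<close>. The penalty is proportional to \<open>p\<close>, so sets of
  small mass fluctuate less.\<close>

lemma prob_count_tail:
  assumes A[measurable]: "A \<in> sets borel" and l: "\<bar>l\<bar> \<le> 1"
  shows "P.prob {\<omega>. L \<le> l * (real (card {s\<in>{1..n}. snd (\<omega> s) \<in> A}) - real n * measure PM A)
    - real n * measure PM A * l\<^sup>2} \<le> exp (- L)"
proof -
  define p where "p = measure PM A"
  have p: "0 \<le> p" by (simp add: p_def)
  let ?y = "\<lambda>s \<omega>. l * (indicator A (snd (\<omega> s)) - p) - p * l\<^sup>2"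
  have mgf: "(\<integral>\<^sup>+ z. exp (l * (indicator A (snd z) - p) - p * l\<^sup>2) \<partial>Q) \<le> 1"
  proof -
    have "(\<integral>\<^sup>+ z. exp (l * (indicator A (snd z) - p) - p * l\<^sup>2) \<partial>Q)
      = (\<integral>\<^sup>+ y. exp (l * (indicator A y - p) - p * l\<^sup>2) \<partial>PM)"
      by (subst Q.nn_integral_snd[symmetric]) (auto simp: V.emeasure_space_1[unfolded V.space_eq_univ])
    also have "\<dots> = (\<integral>\<^sup>+ y. ennreal (exp (- l * p - p * l\<^sup>2) * (1 + (exp l - 1) * indicator A y)) \<partial>PM)"
      by (intro nn_integral_cong) (auto simp: indicator_def exp_add[symmetric] algebra_simps)
    also have "\<dots> = ennreal (\<integral>y. exp (- l * p - p * l\<^sup>2) * (1 + (exp l - 1) * indicator A y) \<partial>PM)"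
    proof (intro nn_integral_eq_integral AE_I2)
      show "integrable PM (\<lambda>y. exp (- l * p - p * l\<^sup>2) * (1 + (exp l - 1) * indicator A y))"
        by (intro integrable_mult_right Bochner_Integration.integrable_add) (auto simp: M.emeasure_eq_measure)
    qed (auto simp: indicator_def)
    also have "(\<integral>y. exp (- l * p - p * l\<^sup>2) * (1 + (exp l - 1) * indicator A y) \<partial>PM)
      = exp (- l * p - p * l\<^sup>2) * (1 + (exp l - 1) * p)"
      by (subst integral_mult_right_zero, subst Bochner_Integration.integral_add)
        (auto simp: p_def M.prob_space[unfolded M.space_eq_univ] M.emeasure_eq_measure)
    also have "\<dots> \<le> exp (- l * p - p * l\<^sup>2) * exp ((exp l - 1) * p)"
      by (intro mult_left_mono exp_ge_add_one_self) auto
    also have "\<dots> \<le> exp (- l * p - p * l\<^sup>2) * exp ((l + l\<^sup>2) * p)"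
      using exp_le_quadratic[OF l] p by (intro mult_left_mono iffD2[OF exp_le_cancel_iff] mult_right_mono) auto
    also have "\<dots> = 1" by (simp add: exp_add[symmetric] algebra_simps)
    finally show ?thesis by (simp add: ennreal_leI)
  qed
  have "measure seq.S {\<omega>\<in>space seq.S. L \<le> (\<Sum>s\<in>{1..n}. ?y s \<omega>)} \<le> exp (- L)"
    by (rule seq.prob_exp_supermartingale) (use mgf in \<open>auto\<close>)
  moreover have "(\<Sum>s\<in>{1..n}. ?y s \<omega>) = l * (real (card {s\<in>{1..n}. snd (\<omega> s) \<in> A}) - real n * p) - real n * p * l\<^sup>2" for \<omega> :: "nat \<Rightarrow> real \<times> real"
  proof -
    have "real (card {s\<in>{1..n}. snd (\<omega> s) \<in> A}) = (\<Sum>s\<in>{1..n}. indicator A (snd (\<omega> s)))"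
      unfolding real_card_eq_sum[OF finite_atLeastAtMost] by (intro sum.cong) (auto simp: indicator_def)
    then show ?thesis by (simp add: sum_subtractf right_diff_distrib sum_distrib_left[symmetric])
  qed
  ultimately show ?thesis by (simp add: path_space_def[symmetric] p_def)
qed

text \<open>The variance-sensitive form of the bound is what produces the exponent 1/3; Hoeffding's
  inequality would only give 1/2.\<close>
lemma prob_count_deviation:
  assumes A: "A \<in> sets borel" and l: "0 < l"
  shows "P.prob {\<omega>. 2 * sqrt (real n * measure PM A * l) + l \<le> 
     \<bar>real (card {s\<in>{1..n}. snd (\<omega> s) \<in> A}) - real n * measure PM A\<bar>} \<le> 2 * exp (- l)"
proof -
  define q where "q = real n * measure PM A"
  define D where "D = (\<lambda>\<omega> :: nat \<Rightarrow> real \<times> real. real (card {s\<in>{1..n}. snd (\<omega> s) \<in> A}) - q)"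
  have q: "0 \<le> q" by (simp add: q_def)
  have [measurable]: "D \<in> borel_measurable \<Omega>"
    unfolding D_def using A by (simp add: real_card_eq_sum)
  define x where "x = 2 * sqrt (q * l) + l"
  \<comment> \<open>Chernoff's choice \<open>sqrt (l / q)\<close>, capped at 1 where the quadratic
    bound on \<open>exp\<close> stops. In the capped case \<open>q \<le> sqrt (q * l)\<close>, and
    the additive \<open>l\<close> in \<open>x\<close> supplies the rest.\<close>
  define h where "h = (if q \<le> l then 1 else sqrt (l / q))"
  have h: "0 \<le> h" "h \<le> 1" using q l by (auto simp: h_def)
  have key: "l \<le> h * x - q * h\<^sup>2"
  proof (cases "q \<le> l")
    case True
    have "q \<le> sqrt (q * l)" using True q l by (intro real_le_rsqrt) (auto simp: power2_eq_square intro: mult_left_mono)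
    moreover have "0 \<le> sqrt (q * l)" using q l by simp
    moreover have "h * x - q * h\<^sup>2 = 2 * sqrt (q * l) + l - q" using True by (simp add: h_def x_def)
    ultimately show ?thesis by linarith
  next
    case False
    then have q0: "0 < q" using l by simp
    have hq: "h = sqrt l / sqrt q" using False by (simp add: h_def real_sqrt_divide)
    have "h * sqrt (q * l) = l" using q0 l by (simp add: hq real_sqrt_mult)
    moreover have "q * h\<^sup>2 = l" using False l q0 by (simp add: h_def)
    moreover have "0 \<le> h * l" using h l by simp
    ultimately show ?thesis using l by (simp add: x_def algebra_simps)
  qed
  have sub: "\<sigma> * D \<omega> \<ge> x \<Longrightarrow> l \<le> (\<sigma> * h) * D \<omega> - q * (\<sigma> * h)\<^sup>2" if "\<sigma>\<^sup>2 = 1" for \<sigma> \<omega>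
  proof -
    assume "\<sigma> * D \<omega> \<ge> x"
    then have "h * x \<le> h * (\<sigma> * D \<omega>)" using h by (intro mult_left_mono) auto
    then show ?thesis using key that by (simp add: power_mult_distrib mult_ac)
  qed
  have tail: "P.prob {\<omega>. x \<le> \<sigma> * D \<omega>} \<le> exp (- l)" if "\<sigma>\<^sup>2 = 1" "\<bar>\<sigma>\<bar> = 1" for \<sigma>
  proof -
    have "P.prob {\<omega>. x \<le> \<sigma> * D \<omega>} \<le> P.prob {\<omega>. l \<le> (\<sigma> * h) * D \<omega> - q * (\<sigma> * h)\<^sup>2}"
    proof (rule P.finite_measure_mono)
      have "{\<omega>\<in>space \<Omega>. l \<le> (\<sigma> * h) * D \<omega> - q * (\<sigma> * h)\<^sup>2} \<in> P.events" by measurable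
      then show "{\<omega>. l \<le> (\<sigma> * h) * D \<omega> - q * (\<sigma> * h)\<^sup>2} \<in> P.events" by simp
    qed (use sub that in auto)
    also have "\<dots> \<le> exp (- l)"
      using prob_count_tail[OF A, of "\<sigma> * h" l n] h that by (simp add: D_def q_def abs_mult)
    finally show ?thesis .
  qed
  have ev: "{\<omega>. x \<le> \<sigma> * D \<omega>} \<in> P.events" for \<sigma>
  proof -
    have "{\<omega>\<in>space \<Omega>. x \<le> \<sigma> * D \<omega>} \<in> P.events" by measurable
    then show ?thesis by simp
  qed
  have "P.prob {\<omega>. x \<le> \<bar>D \<omega>\<bar>} = P.prob ({\<omega>. x \<le> 1 * D \<omega>} \<union> {\<omega>. x \<le> -1 * D \<omega>})"
    by (intro arg_cong[of _ _ P.prob]) auto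
  also have "\<dots> \<le> P.prob {\<omega>. x \<le> 1 * D \<omega>} + P.prob {\<omega>. x \<le> -1 * D \<omega>}"
    by (intro measure_Un_le ev)
  also have "\<dots> \<le> exp (- l) + exp (- l)" by (intro add_mono tail) auto
  finally show ?thesis by (simp add: D_def q_def x_def)
qed

text \<open>Lost rounds contribute 0. Given the past, a win depends only on \<open>M_s\<close>,
  independent of \<open>V_s\<close>, so Fubini reduces each round to Hoeffding's lemma. The number
  of wins is random and stays inside the event, while \<open>l\<close> is deterministic.\<close>

lemma prob_value_tail:
  assumes \<sigma>: "\<sigma> = 1 \<or> \<sigma> = -1" and l: "0 < l"
  shows "P.prob {\<omega>. L \<le> l * (\<sigma> * (\<Sum>s\<in>wins \<gamma> \<omega> n. fst (\<omega> s) - v)) - real (card (wins \<gamma> \<omega> n)) * l\<^sup>2 / 8} \<le> exp (- L)"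
proof -
  let ?y = "\<lambda>s \<omega>. if snd (\<omega> s) \<le> ucbid \<gamma> \<omega> s then l * (\<sigma> * (fst (\<omega> s) - v)) - l\<^sup>2 / 8 else 0"
  have mgf: "(\<integral>\<^sup>+ z. exp (if snd z \<le> b then l * (\<sigma> * (fst z - v)) - l\<^sup>2 / 8 else 0) \<partial>Q) \<le> 1" for b
  proof -
    have one: "(\<integral>\<^sup>+ x. exp (l * (\<sigma> * (x - v)) - l\<^sup>2 / 8) \<partial>PV) \<le> 1"
    proof -
      have "(\<integral>\<^sup>+ x. exp (l * (\<sigma> * (x - v)) - l\<^sup>2 / 8) \<partial>PV)
        = (\<integral>\<^sup>+ x. ennreal (exp (- l\<^sup>2 / 8)) * ennreal (exp (l * (\<sigma> * (x - v)))) \<partial>PV)"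
        by (intro nn_integral_cong) (simp add: ennreal_mult[symmetric] exp_add[symmetric])
      also have "\<dots> = ennreal (exp (- l\<^sup>2 / 8)) * (\<integral>\<^sup>+ x. exp (l * (\<sigma> * (x - v))) \<partial>PV)"
        by (intro nn_integral_cmult) simp
      also have "\<dots> \<le> ennreal (exp (- l\<^sup>2 / 8)) * ennreal (exp (l\<^sup>2 / 8))"
        by (intro mult_left_mono hoeffding_V \<sigma> l) auto
      also have "\<dots> = 1" by (simp add: ennreal_mult[symmetric] exp_add[symmetric])
      finally show ?thesis .
    qed
    have "(\<integral>\<^sup>+ z. exp (if snd z \<le> b then l * (\<sigma> * (fst z - v)) - l\<^sup>2 / 8 else 0) \<partial>Q)
      = (\<integral>\<^sup>+ y. \<integral>\<^sup>+ x. exp (if y \<le> b then l * (\<sigma> * (x - v)) - l\<^sup>2 / 8 else 0) \<partial>PV \<partial>PM)"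
      by (subst Q.nn_integral_snd[symmetric]) (simp_all cong: if_cong)
    also have "\<dots> \<le> (\<integral>\<^sup>+ y. 1 \<partial>PM)"
    proof (intro nn_integral_mono)
      fix y
      show "(\<integral>\<^sup>+ x. exp (if y \<le> b then l * (\<sigma> * (x - v)) - l\<^sup>2 / 8 else 0) \<partial>PV) \<le> 1"
        using one by (cases "y \<le> b") (simp_all add: V.emeasure_space_1[unfolded V.space_eq_univ])
    qed
    also have "\<dots> = 1" by (simp add: M.emeasure_space_1[unfolded M.space_eq_univ])
    finally show ?thesis .
  qed
  have "measure seq.S {\<omega>\<in>space seq.S. L \<le> (\<Sum>s\<in>{1..n}. ?y s \<omega>)} \<le> exp (- L)"
  proof (rule seq.prob_exp_supermartingale)
    fix s assume s: "s \<in> {1..n}"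
    show "?y s \<in> borel_measurable seq.S"
    proof -
      have [measurable]: "(\<lambda>\<omega>. ucbid \<gamma> \<omega> s) \<in> borel_measurable \<Omega>" using s by (intro measurable_bid) auto
      show ?thesis unfolding path_space_eq[symmetric] by measurable
    qed
    fix \<omega> :: "nat \<Rightarrow> real \<times> real"
    have "ucbid \<gamma> (fun_upd \<omega> s (z)) s = ucbid \<gamma> \<omega> s" for z using s by (intro ucbid_cong) auto
    then show "(\<integral>\<^sup>+ z. exp (?y s (fun_upd \<omega> s (z))) \<partial>Q) \<le> 1" using mgf by (simp cong: if_cong)
    fix \<omega>' :: "nat \<Rightarrow> real \<times> real" assume eq: "\<And>r. r \<le> s \<Longrightarrow> \<omega> r = \<omega>' r"
    then have "ucbid \<gamma> \<omega> s = ucbid \<gamma> \<omega>' s" using s by (intro ucbid_cong) auto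
    then show "?y s \<omega> = ?y s \<omega>'" using eq by simp
  qed
  moreover have "(\<Sum>s\<in>{1..n}. ?y s \<omega>) = l * (\<sigma> * (\<Sum>s\<in>wins \<gamma> \<omega> n. fst (\<omega> s) - v)) - real (card (wins \<gamma> \<omega> n)) * l\<^sup>2 / 8" for \<omega>
  proof -
    have "(\<Sum>s\<in>{1..n}. ?y s \<omega>) = (\<Sum>s\<in>wins \<gamma> \<omega> n. l * (\<sigma> * (fst (\<omega> s) - v)) - l\<^sup>2 / 8)"
      by (simp add: wins_def sum.If_cases Int_def)
    also have "\<dots> = (\<Sum>s\<in>wins \<gamma> \<omega> n. l * (\<sigma> * (fst (\<omega> s) - v))) - real (card (wins \<gamma> \<omega> n)) * l\<^sup>2 / 8"
      by (subst sum_subtractf) simp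
    finally show ?thesis by (simp only: sum_distrib_left)
  qed
  ultimately show ?thesis by (simp add: path_space_def[symmetric])
qed

end

section \<open>Elementary inequalities behind the rate\<close>

lemma sum_powr_le: "(\<Sum>j\<in>{1..n}. real j powr (-2/3)) \<le> 3 * real n powr (1/3)"
proof (induction n)
  case (Suc n)
  define a where "a = real (Suc n) powr (1/3)"
  define b where "b = real n powr (1/3)"
  have cube: "(x powr (1/3)) ^ 3 = x" if "0 \<le> x" for x :: real
    using that by (cases "x = 0") (auto simp: powr_power)
  have ab: "a ^ 3 - b ^ 3 = 1" "0 < a" "0 \<le> b" "b \<le> a"
    unfolding a_def b_def by (auto simp: cube powr_mono2)
  \<comment> \<open>As \<open>a^3 - b^3 = 1\<close>, the increment \<open>a - b\<close> is the
    reciprocal of this sum, hence at least \<open>1 / (3 * a^2)\<close>; the summands telescope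
    against cube roots.\<close>
  have "a\<^sup>2 + a * b + b\<^sup>2 \<le> a\<^sup>2 + a * a + a\<^sup>2"
    using ab by (intro add_mono mult_left_mono power_mono) auto
  then have "(a - b) * (a\<^sup>2 + a * b + b\<^sup>2) \<le> (a - b) * (3 * a\<^sup>2)"
    using ab by (intro mult_left_mono) (auto simp: power2_eq_square)
  moreover have "(a - b) * (a\<^sup>2 + a * b + b\<^sup>2) = 1"
    using ab(1) by (simp add: algebra_simps power2_eq_square power3_eq_cube)
  ultimately have "1 / a\<^sup>2 \<le> 3 * (a - b)" using ab by (simp add: field_simps)
  moreover have "a\<^sup>2 = real (Suc n) powr (2/3)" unfolding a_def by (subst powr_power) auto
  then have "1 / a\<^sup>2 = real (Suc n) powr (-2/3)" using powr_minus_divide[of "real (Suc n)" "2/3"] by simp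
  ultimately show ?case using Suc.IH by (simp add: a_def b_def)
qed simp

text \<open>At the scale \<open>p = r powr (1/3)\<close>, either \<open>x \<le> p\<close>, or
  \<open>x\<close> exceeds \<open>r\<close>, so \<open>sqrt (x * r)\<close> dominates
  \<open>r\<close> and the two bounds on \<open>G\<close> combine to
  \<open>x^3 \<le> (2 * A / \<kappa>)^2 * r\<close>. Reinserting \<open>x = O(p)\<close> bounds
  \<open>G\<close> by \<open>O(p^2)\<close>.\<close>

lemma self_bounding_cubic:
  fixes x r G A \<kappa> :: real
  assumes "0 < \<kappa>" "0 \<le> A" "0 \<le> x" "0 \<le> r" "r \<le> 1"
    and G: "\<kappa> * x\<^sup>2 \<le> G" "G \<le> A * (sqrt (x * r) + r)"
  shows "G \<le> A * (2 + (2 * A / \<kappa>)\<^sup>2) * r powr (2/3)"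
proof -
  define p where "p = r powr (1/3)"
  have p: "0 \<le> p" "p \<le> 1" using assms by (auto simp: p_def intro: powr_le1)
  have r: "r = p ^ 3" using assms by (cases "r = 0") (auto simp: p_def powr_power)
  have p2: "r powr (2/3) = p\<^sup>2" using assms by (cases "r = 0") (auto simp: p_def powr_power)
  \<comment> \<open>The summand 1 gives \<open>C \<ge> 1\<close>: this settles the case
    \<open>x \<le> p\<close> and allows \<open>C \<le> C^3\<close> when taking the cube
    root.\<close>
  define C where "C = 1 + (2 * A / \<kappa>)\<^sup>2"
  have C: "1 \<le> C" by (simp add: C_def)
  have xC: "x \<le> C * p"
  proof (cases "x \<le> p")
    case True
    then show ?thesis using mult_right_mono[OF C p(1)] by simp
  next
    case False
    have "p ^ 3 \<le> p ^ 1" using p by (intro power_decreasing) auto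
    then have "p ^ 3 \<le> x" using False by simp
    then have "r * r \<le> x * r" using r assms by (intro mult_right_mono) auto
    then have "r \<le> sqrt (x * r)" by (intro real_le_rsqrt) (simp add: power2_eq_square)
    then have "A * (sqrt (x * r) + r) \<le> A * (2 * sqrt (x * r))" using assms by (intro mult_left_mono) auto
    then have "\<kappa> * x\<^sup>2 \<le> 2 * A * sqrt (x * r)" using G by simp
    then have "x\<^sup>2 \<le> (2 * A / \<kappa>) * sqrt (x * r)" using assms(1) by (simp add: field_simps)
    then have "(x\<^sup>2)\<^sup>2 \<le> ((2 * A / \<kappa>) * sqrt (x * r))\<^sup>2" by (intro power_mono) auto
    also have "\<dots> = (2 * A / \<kappa>)\<^sup>2 * (x * r)" using assms by (subst power_mult_distrib) simp
    finally have "x * x ^ 3 \<le> x * ((2 * A / \<kappa>)\<^sup>2 * r)" by (simp add: power2_eq_square power3_eq_cube mult_ac)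
    moreover have "0 < x" using False p by simp
    ultimately have "x ^ 3 \<le> (2 * A / \<kappa>)\<^sup>2 * r" by simp
    also have "\<dots> \<le> C * r" using assms by (intro mult_right_mono) (auto simp: C_def)
    also have "\<dots> \<le> C ^ 3 * p ^ 3"
      unfolding r using C p power_increasing[of 1 3 C] by (intro mult_right_mono) auto
    also have "\<dots> = (C * p) ^ 3" by (simp add: power_mult_distrib)
    finally show ?thesis using C p by (subst (asm) power_mono_iff) (use assms in auto)
  qed
  have "x * r \<le> C * p * p ^ 3" unfolding r using xC p by (intro mult_right_mono) auto
  also have "\<dots> = C * (p\<^sup>2)\<^sup>2" by (simp add: power2_eq_square power3_eq_cube)
  also have "\<dots> \<le> C\<^sup>2 * (p\<^sup>2)\<^sup>2" using C by (intro mult_right_mono) (auto simp: power2_eq_square)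
  also have "\<dots> = (C * p\<^sup>2)\<^sup>2" by (simp add: power_mult_distrib)
  finally have "sqrt (x * r) \<le> C * p\<^sup>2" using C by (intro real_le_lsqrt) auto
  moreover have "r \<le> p\<^sup>2" unfolding r using p by (intro power_decreasing) auto
  ultimately have "A * (sqrt (x * r) + r) \<le> A * (C * p\<^sup>2 + p\<^sup>2)" using assms by (intro mult_left_mono) auto
  then show ?thesis using G unfolding p2 C_def by (simp add: algebra_simps)
qed

lemma powr_two_thirds_le: "0 \<le> y \<Longrightarrow> y powr (2/3) \<le> 1 + y" for y :: real
proof (cases "y \<le> 1")
  case True
  assume "0 \<le> y"
  then have "y powr (2/3) \<le> 1" using True by (intro powr_le1) auto
  then show ?thesis using \<open>0 \<le> y\<close> by simp
next
  case False
  then have "y powr (2/3) \<le> y powr 1" by (intro powr_mono) auto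
  then show ?thesis using False by simp
qed

lemma exp_minus_2_ln: "0 < x \<Longrightarrow> exp (- (2 * ln x)) = 1 / x\<^sup>2" for x :: real
  using exp_of_nat_mult[of 2 "ln x"] by (simp add: exp_minus inverse_eq_divide)

section \<open>Failure events and their probabilities\<close>

locale ucbid_regret = auction +
  fixes f :: "real \<Rightarrow> real" and \<kappa> K :: real
  assumes log_concave: "log_concave_cdf (cdf PM) f (mean_val PV)"
    and K: "1 \<le> K" "\<And>x y. 0 \<le> x \<Longrightarrow> x \<le> y \<Longrightarrow> y \<le> 1 \<Longrightarrow> cdf PM y - cdf PM x \<le> K * (y - x)"
    and kappa: "0 < \<kappa>" "\<And>b. b \<in> {0..1} \<Longrightarrow> \<kappa> * (b - bstar (mean_val PV) (cdf PM))\<^sup>2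
      \<le> util (mean_val PV) (cdf PM) (bstar (mean_val PV) (cdf PM)) - util (mean_val PV) (cdf PM) b"
    and bstar_pos: "0 < cdf PM (bstar (mean_val PV) (cdf PM))"
begin

sublocale log_concave_cdf F f v by (rule log_concave)

definition rate :: "nat \<Rightarrow> real" where "rate n = 2 * ln (real n) / real n"

definition off_support :: "(nat \<Rightarrow> real \<times> real) set" where
  "off_support = {\<omega>. \<not> (\<forall>s. snd (\<omega> s) \<in> {0..1})}"

text \<open>\<open>l\<close> is four times the width \<open>w\<close> for \<open>k\<close> wins, the
  optimal Chernoff parameter for that number. If there are exactly \<open>k\<close> wins, the event
  says that the signed deviation of the sum is at least \<open>k * w\<close>. It is not intersected
  with that condition, since the tail bound holds for each fixed \<open>l\<close>.\<close>

definition bad_value :: "nat \<Rightarrow> nat \<Rightarrow> real \<Rightarrow> (nat \<Rightarrow> real \<times> real) set" where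
  "bad_value n k \<sigma> = (let l = 4 * sqrt (\<gamma> * ln (real n) / (2 * real k)) in
    {\<omega>. \<gamma> * ln (real n) \<le> l * (\<sigma> * (\<Sum>s\<in>wins \<gamma> \<omega> n. fst (\<omega> s) - v)) - real (card (wins \<gamma> \<omega> n)) * l\<^sup>2 / 8})"

definition bad_count :: "nat \<Rightarrow> real set \<Rightarrow> (nat \<Rightarrow> real \<times> real) set" where
  "bad_count n A = {\<omega>. 2 * sqrt (real n * measure PM A * (2 * ln (real n))) + 2 * ln (real n) \<le>
     \<bar>real (card {s\<in>{1..n}. snd (\<omega> s) \<in> A}) - real n * measure PM A\<bar>}"

text \<open>The bid is data-dependent, so the mass between \<open>bs\<close> and every multiple of
  \<open>1 / n\<close> is controlled simultaneously; rounding a bid to the grid costs only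
  \<open>K / n\<close>. The half-line gives the deviation at \<open>bs\<close> itself.\<close>

definition grid :: "nat \<Rightarrow> real set set" where
  "grid n = insert {..bs} ((\<lambda>k. {min bs (real k / real n)<..max bs (real k / real n)}) ` {0..n})"

definition bad :: "nat \<Rightarrow> (nat \<Rightarrow> real \<times> real) set" where
  "bad n = off_support \<union> (\<Union>k\<in>{1..n}. \<Union>\<sigma>\<in>{1, -1}. bad_value n k \<sigma>) \<union> (\<Union>A\<in>grid n. bad_count n A)"

lemma measurable_wins [measurable]:
  "(\<lambda>\<omega>. real (card (wins \<gamma> \<omega> n))) \<in> borel_measurable \<Omega>"
  "(\<lambda>\<omega>. \<Sum>s\<in>wins \<gamma> \<omega> n. fst (\<omega> s) - v) \<in> borel_measurable \<Omega>"
proof -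
  have [measurable]: "(\<lambda>\<omega>. ucbid \<gamma> \<omega> s) \<in> borel_measurable \<Omega>" if "s \<in> {1..n}" for s
    using that by (intro measurable_bid) auto
  have W: "real (card (wins \<gamma> \<omega> n)) = (\<Sum>s\<in>{1..n}. if snd (\<omega> s) \<le> ucbid \<gamma> \<omega> s then 1 else 0)"
    and S: "(\<Sum>s\<in>wins \<gamma> \<omega> n. fst (\<omega> s) - v) = (\<Sum>s\<in>{1..n}. if snd (\<omega> s) \<le> ucbid \<gamma> \<omega> s then fst (\<omega> s) - v else 0)" for \<omega>
    by (simp_all add: wins_def real_card_eq_sum sum.If_cases Int_def)
  show "(\<lambda>\<omega>. real (card (wins \<gamma> \<omega> n))) \<in> borel_measurable \<Omega>" unfolding W by measurable
  show "(\<lambda>\<omega>. \<Sum>s\<in>wins \<gamma> \<omega> n. fst (\<omega> s) - v) \<in> borel_measurable \<Omega>" unfolding S by measurable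
qed

lemma measurable_count [measurable]:
  assumes [measurable]: "A \<in> sets borel"
  shows "(\<lambda>\<omega>. real (card {s\<in>{1..n}. snd (\<omega> s) \<in> A})) \<in> borel_measurable \<Omega>"
  unfolding real_card_eq_sum[OF finite_atLeastAtMost] by measurable

lemma off_support_null: "off_support \<in> P.events" "P.prob off_support = 0"
proof -
  have "{\<omega>\<in>space \<Omega>. \<not> (\<forall>s. snd (\<omega> s) \<in> {0..1})} \<in> P.events" by measurable
  then show e: "off_support \<in> P.events" by (simp add: off_support_def)
  show "P.prob off_support = 0"
    using AE_path_M by (subst P.prob_eq_0[OF e]) (simp add: off_support_def)
qed

lemma bad_value_event: "bad_value n k \<sigma> \<in> P.events"
proof -
  have "{\<omega>\<in>space \<Omega>. \<gamma> * ln (real n) \<le> l * (\<sigma> * (\<Sum>s\<in>wins \<gamma> \<omega> n. fst (\<omega> s) - v)) - real (card (wins \<gamma> \<omega> n)) * l\<^sup>2 / 8} \<in> P.events" for l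
    by measurable
  then show ?thesis unfolding bad_value_def Let_def by (simp only: space_path UNIV_I simp_thms)
qed

lemma bad_count_event: assumes [measurable]: "A \<in> sets borel" shows "bad_count n A \<in> P.events"
proof -
  have "{\<omega>\<in>space \<Omega>. 2 * sqrt (real n * measure PM A * (2 * ln (real n))) + 2 * ln (real n) \<le>
     \<bar>real (card {s\<in>{1..n}. snd (\<omega> s) \<in> A}) - real n * measure PM A\<bar>} \<in> P.events"
    by measurable
  then show ?thesis by (simp add: bad_count_def)
qed

lemma grid_borel: "A \<in> grid n \<Longrightarrow> A \<in> sets borel"
  by (auto simp: grid_def)

lemma finite_grid: "finite (grid n)"
  by (simp add: grid_def)

lemma bad_event [measurable]: "bad n \<in> P.events"
  unfolding bad_def using off_support_null(1) bad_value_event bad_count_event grid_borel finite_grid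
  by (intro sets.Un sets.finite_UN) auto

lemma prob_bad_count:
  assumes "2 \<le> n" "A \<in> sets borel" shows "P.prob (bad_count n A) \<le> 2 / (real n)\<^sup>2"
proof -
  have "exp (- (2 * ln (real n))) = 1 / (real n)\<^sup>2"
    using assms(1) by (intro exp_minus_2_ln) simp
  then show ?thesis
    using prob_count_deviation[OF assms(2), of "2 * ln (real n)" n] assms(1) by (simp add: bad_count_def)
qed

lemma prob_bad_value:
  assumes "2 \<le> n" "1 \<le> k" "\<sigma> \<in> {1, -1}" shows "P.prob (bad_value n k \<sigma>) \<le> 1 / (real n)\<^sup>2"
proof -
  have ln: "0 < ln (real n)" using assms(1) by simp
  have "P.prob (bad_value n k \<sigma>) \<le> exp (- (\<gamma> * ln (real n)))"
    unfolding bad_value_def Let_def using assms gamma ln by (intro prob_value_tail) auto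
  also have "\<dots> \<le> exp (- (2 * ln (real n)))" using gamma ln by simp
  also have "\<dots> = 1 / (real n)\<^sup>2"
    using assms(1) by (intro exp_minus_2_ln) simp
  finally show ?thesis .
qed

text \<open>Since \<open>\<gamma> > 2\<close>, each value event costs at most
  \<open>1 / n^2\<close>; \<open>n\<close> values of \<open>k\<close> and two signs give
  \<open>2 / n\<close>. At most \<open>n + 2 \<le> 2 * n\<close> grid sets at \<open>2 / n^2\<close>
  each add \<open>4 / n\<close>.\<close>

lemma prob_bad: assumes n: "2 \<le> n" shows "P.prob (bad n) \<le> 6 / real n"
proof -
  have "P.prob (\<Union>\<sigma>\<in>{1, -1}. bad_value n k \<sigma>) \<le> 2 / (real n)\<^sup>2" if "k \<in> {1..n}" for k
  proof -
    have "P.prob (\<Union>\<sigma>\<in>{1, -1}. bad_value n k \<sigma>) \<le> (\<Sum>\<sigma>\<in>{1, -1}. P.prob (bad_value n k \<sigma>))"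
      by (intro measure_UNION_le bad_value_event) auto
    also have "\<dots> \<le> (\<Sum>\<sigma>\<in>{1, -1::real}. 1 / (real n)\<^sup>2)"
      using that n by (intro sum_mono prob_bad_value) auto
    finally show ?thesis by simp
  qed
  then have "(\<Sum>k\<in>{1..n}. P.prob (\<Union>\<sigma>\<in>{1, -1}. bad_value n k \<sigma>)) \<le> (\<Sum>k\<in>{1..n}. 2 / (real n)\<^sup>2)"
    by (intro sum_mono) auto
  moreover have "P.prob (\<Union>k\<in>{1..n}. \<Union>\<sigma>\<in>{1, -1}. bad_value n k \<sigma>) \<le> (\<Sum>k\<in>{1..n}. P.prob (\<Union>\<sigma>\<in>{1, -1}. bad_value n k \<sigma>))"
    by (intro measure_UNION_le sets.finite_UN bad_value_event) auto
  ultimately have V: "P.prob (\<Union>k\<in>{1..n}. \<Union>\<sigma>\<in>{1, -1}. bad_value n k \<sigma>) \<le> 2 / real n"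
    using n by (simp add: power2_eq_square)
  have "P.prob (\<Union>A\<in>grid n. bad_count n A) \<le> (\<Sum>A\<in>grid n. P.prob (bad_count n A))"
    by (intro measure_UNION_le bad_count_event finite_grid grid_borel)
  also have "\<dots> \<le> (\<Sum>A\<in>grid n. 2 / (real n)\<^sup>2)"
    using n by (intro sum_mono prob_bad_count grid_borel)
  also have "\<dots> = real (card (grid n)) * (2 / (real n)\<^sup>2)" by simp
  also have "\<dots> \<le> (2 * real n) * (2 / (real n)\<^sup>2)"
  proof (intro mult_right_mono)
    have "card (grid n) \<le> Suc (card ((\<lambda>k. {min bs (real k / real n)<..max bs (real k / real n)}) ` {0..n}))"
      unfolding grid_def by (rule card_insert_le_m1) auto
    also have "\<dots> \<le> Suc (card {0..n})" by (intro Suc_le_mono[THEN iffD2] card_image_le) auto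
    finally show "real (card (grid n)) \<le> 2 * real n" using n by simp
  qed auto
  also have "\<dots> = 4 / real n" using n by (simp add: power2_eq_square)
  finally have C: "P.prob (\<Union>A\<in>grid n. bad_count n A) \<le> 4 / real n" .
  have "P.prob (bad n) \<le> P.prob (off_support \<union> (\<Union>k\<in>{1..n}. \<Union>\<sigma>\<in>{1, -1}. bad_value n k \<sigma>)) + P.prob (\<Union>A\<in>grid n. bad_count n A)"
    unfolding bad_def using off_support_null(1) bad_value_event bad_count_event grid_borel finite_grid
    by (intro measure_Un_le sets.Un sets.finite_UN) auto
  also have "P.prob (off_support \<union> (\<Union>k\<in>{1..n}. \<Union>\<sigma>\<in>{1, -1}. bad_value n k \<sigma>)) \<le> P.prob off_support + P.prob (\<Union>k\<in>{1..n}. \<Union>\<sigma>\<in>{1, -1}. bad_value n k \<sigma>)"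
    using off_support_null(1) bad_value_event by (intro measure_Un_le sets.finite_UN) auto
  finally show ?thesis using V C off_support_null(2) by (simp add: field_simps)
qed

section \<open>The gap outside the bad events\<close>

definition cnt :: "(nat \<Rightarrow> real \<times> real) \<Rightarrow> nat \<Rightarrow> real \<Rightarrow> real" where
  "cnt \<omega> n b = real (card {s\<in>{1..n}. snd (\<omega> s) \<le> b})"

lemma cnt_mono: "a \<le> b \<Longrightarrow> cnt \<omega> n a \<le> cnt \<omega> n b"
  unfolding cnt_def by (auto intro!: card_mono)

lemma cnt_diff:
  assumes "a \<le> b" shows "real (card {s\<in>{1..n}. snd (\<omega> s) \<in> {a<..b}}) = cnt \<omega> n b - cnt \<omega> n a"
proof -
  have "{s\<in>{1..n}. snd (\<omega> s) \<le> b} = {s\<in>{1..n}. snd (\<omega> s) \<le> a} \<union> {s\<in>{1..n}. snd (\<omega> s) \<in> {a<..b}}"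
    using assms by auto
  then have "card {s\<in>{1..n}. snd (\<omega> s) \<le> b} = card {s\<in>{1..n}. snd (\<omega> s) \<le> a} + card {s\<in>{1..n}. snd (\<omega> s) \<in> {a<..b}}"
    by (simp only:) (intro card_Un_disjoint; auto)
  then show ?thesis by (simp add: cnt_def)
qed

lemma measure_Ioc: "a \<le> b \<Longrightarrow> measure PM {a<..b} = F b - F a"
  by (cases "a = b") (auto simp: M.cdf_diff_eq)

text \<open>\<open>rate n \<le> 1\<close> allows replacing \<open>rate n\<close> by its square root;
  \<open>1 / n \<le> rate n\<close> absorbs the mesh of the grid.\<close>

lemma rate_bounds:
  assumes "2 \<le> n" shows "0 < rate n" "rate n \<le> 1" "1 / real n \<le> rate n"
proof -
  have n: "2 \<le> real n" using assms by simp
  show "0 < rate n" using n by (simp add: rate_def)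
  have "ln (real n) = ln (real n / 2) + ln 2" using n by (simp add: ln_div)
  moreover have "ln (real n / 2) \<le> real n / 2 - 1" using n by (intro ln_le_minus_one) auto
  ultimately have "ln (real n) \<le> real n / 2" using ln_2_less_1 by linarith
  then show "rate n \<le> 1" using n by (simp add: rate_def field_simps)
  have "ln 2 \<le> ln (real n)" using n by simp
  then have "1 \<le> 2 * ln (real n)" using ln2_ge_two_thirds by linarith
  then show "1 / real n \<le> rate n" using n by (simp add: rate_def divide_right_mono)
qed

lemma rate_tendsto_0: "rate \<longlonglongrightarrow> 0"
proof -
  have "(\<lambda>n. 2 * (ln (real n) / real n)) \<longlonglongrightarrow> 2 * 0"
    by (intro tendsto_mult tendsto_const filterlim_compose[OF lim_ln_over_n[unfolded o_def]] lim_ln_over_n)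
  then show ?thesis by (simp add: rate_def[abs_def])
qed

lemma good_count:
  assumes "\<omega> \<notin> bad_count n A" "2 \<le> n"
  shows "\<bar>real (card {s\<in>{1..n}. snd (\<omega> s) \<in> A}) - real n * measure PM A\<bar>
     \<le> real n * (2 * sqrt (measure PM A * rate n) + rate n)"
proof -
  have n: "0 < real n" using assms by simp
  have eq: "real n * measure PM A * (2 * ln (real n)) = (real n)\<^sup>2 * (measure PM A * rate n)"
    using n by (simp add: rate_def power2_eq_square)
  have "sqrt (real n * measure PM A * (2 * ln (real n))) = real n * sqrt (measure PM A * rate n)"
    unfolding eq using n by (simp add: real_sqrt_mult[of "(real n)\<^sup>2"])
  moreover have "2 * ln (real n) = real n * rate n" using n by (simp add: rate_def)
  ultimately have "\<bar>real (card {s\<in>{1..n}. snd (\<omega> s) \<in> A}) - real n * measure PM A\<bar>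
    < 2 * (real n * sqrt (measure PM A * rate n)) + real n * rate n"
    using assms(1) unfolding bad_count_def by (simp only: mem_Collect_eq not_le)
  then show ?thesis by (simp add: algebra_simps)
qed

text \<open>The crude order \<open>sqrt (rate n)\<close> suffices at the fixed point
  \<open>bs\<close>: there the deviation is either multiplied by the distance from the bid to
  \<open>bs\<close> or only has to stay below \<open>F bs\<close>.\<close>

lemma good_count_bstar:
  assumes "\<omega> \<notin> bad n" "2 \<le> n"
  shows "\<bar>cnt \<omega> n bs / real n - F bs\<bar> \<le> 3 * sqrt (rate n)"
proof -
  have n: "0 < real n" using assms by simp
  have r: "0 < rate n" "rate n \<le> 1" using rate_bounds assms(2) by auto
  have "\<omega> \<notin> bad_count n {..bs}" using assms(1) by (auto simp: bad_def grid_def)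
  from good_count[OF this assms(2)]
  have "\<bar>cnt \<omega> n bs - real n * F bs\<bar> \<le> real n * (2 * sqrt (F bs * rate n) + rate n)"
    by (simp add: cnt_def cdf_def)
  also have "\<dots> \<le> real n * (2 * sqrt (1 * rate n) + sqrt (rate n))"
  proof (intro mult_left_mono add_mono real_sqrt_le_mono mult_right_mono)
    show "rate n \<le> sqrt (rate n)"
      using r by (intro real_le_rsqrt) (auto simp: power2_eq_square intro: mult_left_le)
  qed (use F_le_1 r in auto)
  finally have "\<bar>cnt \<omega> n bs - real n * F bs\<bar> \<le> real n * (3 * sqrt (rate n))" by simp
  moreover have "cnt \<omega> n bs - real n * F bs = real n * (cnt \<omega> n bs / real n - F bs)"
    using n by (simp add: field_simps)
  ultimately have "real n * \<bar>cnt \<omega> n bs / real n - F bs\<bar> \<le> real n * (3 * sqrt (rate n))"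
    by (simp add: abs_mult)
  then show ?thesis using n by simp
qed

text \<open>Chernoff's bound on the neighbouring grid interval, whose mass is at most
  \<open>K * (\<bar>b - bs\<bar> + r)\<close>. An upper bound suffices because the increment will
  carry a nonnegative factor.\<close>

lemma good_count_local:
  assumes "\<omega> \<notin> bad n" "2 \<le> n" "b \<in> {0..1}"
  shows "(cnt \<omega> n b - cnt \<omega> n bs) / real n - (F b - F bs)
    \<le> 2 * sqrt (K * \<bar>b - bs\<bar> * rate n) + (3 * K + 1) * rate n"
proof -
  define r where "r = rate n"
  have n: "0 < real n" using assms by simp
  have r: "0 < r" "r \<le> 1" "1 / real n \<le> r" using rate_bounds assms(2) by (auto simp: r_def)
  \<comment> \<open>Rounding up makes \<open>cnt\<close> larger, the right direction for an upper
    bound; only \<open>F a - F b\<close> has to be paid for.\<close>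
  define k where "k = nat \<lceil>real n * b\<rceil>"
  define a where "a = real k / real n"
  have k: "real n * b \<le> real k" "real k < real n * b + 1"
    using assms(3) n unfolding k_def by (auto simp: of_nat_nat ceiling_correct mult_nonneg_nonneg; linarith)+
  have "real n * b \<le> real n" using assms(3) n by (simp add: mult_left_le)
  then have "\<lceil>real n * b\<rceil> \<le> int n" unfolding ceiling_le_iff by simp
  then have kn: "k \<le> n" by (simp only: k_def nat_le_iff)
  have a: "b \<le> a" "a \<le> b + 1 / real n" "a \<le> 1" "0 \<le> a"
    using k n kn by (auto simp: a_def field_simps)
  have b01: "0 \<le> bs" "bs \<le> 1" using bstar_mem by auto
  have "\<omega> \<notin> bad_count n {min bs a<..max bs a}"
    using assms(1) kn by (auto simp: bad_def grid_def a_def)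
  from good_count[OF this assms(2)]
  have dev: "\<bar>(cnt \<omega> n (max bs a) - cnt \<omega> n (min bs a)) - real n * (F (max bs a) - F (min bs a))\<bar>
    \<le> real n * (2 * sqrt ((F (max bs a) - F (min bs a)) * r) + r)"
    by (simp only: cnt_diff[OF min.coboundedI1[OF max.cobounded1]] measure_Ioc[OF min.coboundedI1[OF max.cobounded1]] r_def)
  have Kr: "K / real n \<le> K * r" using mult_left_mono[OF r(3), of K] K(1) by simp
  have Fb: "F a - F b \<le> K * r"
    using K(2)[of b a] a assms(3) K(1) mult_left_mono[of "a - b" "1 / real n" K] Kr by auto
  have s: "sqrt ((F (max bs a) - F (min bs a)) * r) \<le> sqrt (K * \<bar>b - bs\<bar> * r) + K * r"
  proof -
    have "F (max bs a) - F (min bs a) \<le> K * (max bs a - min bs a)"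
      using b01 a by (intro K(2)) auto
    also have "\<dots> \<le> K * (\<bar>b - bs\<bar> + r)"
      using a r K(1) by (intro mult_left_mono) auto
    finally have "(F (max bs a) - F (min bs a)) * r \<le> K * (\<bar>b - bs\<bar> + r) * r"
      using r by (intro mult_right_mono) auto
    also have "\<dots> = K * \<bar>b - bs\<bar> * r + K * r\<^sup>2" by (simp add: algebra_simps power2_eq_square)
    finally have "sqrt ((F (max bs a) - F (min bs a)) * r) \<le> sqrt (K * \<bar>b - bs\<bar> * r + K * r\<^sup>2)"
      by (rule real_sqrt_le_mono)
    also have "\<dots> \<le> sqrt (K * \<bar>b - bs\<bar> * r) + sqrt (K * r\<^sup>2)"
      using K(1) r by (intro sqrt_add_le_add_sqrt) auto
    also have "sqrt (K * r\<^sup>2) \<le> K * r"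
      using K(1) r by (intro real_le_lsqrt) (auto simp: power_mult_distrib power2_eq_square intro!: mult_right_mono)
    finally show ?thesis by simp
  qed
  have rhs: "(2 * sqrt ((F (max bs a) - F (min bs a)) * r) + r) \<le> 2 * sqrt (K * \<bar>b - bs\<bar> * r) + (2 * K + 1) * r"
    using s by (simp add: algebra_simps)
  note dev' = order_trans[OF dev mult_left_mono[OF rhs of_nat_0_le_iff]]
  have "cnt \<omega> n b - cnt \<omega> n bs \<le> real n * (F b - F bs) + real n * (2 * sqrt (K * \<bar>b - bs\<bar> * r) + (2 * K + 1) * r) + real n * (K * r)"
  proof (cases "bs \<le> a")
    case True
    have "cnt \<omega> n b \<le> cnt \<omega> n a" by (rule cnt_mono) (rule a)
    moreover have "(cnt \<omega> n a - cnt \<omega> n bs) - real n * (F a - F bs) \<le> real n * (2 * sqrt (K * \<bar>b - bs\<bar> * r) + (2 * K + 1) * r)"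
      using dev' True by (simp add: max_absorb2 min_absorb1 abs_le_iff)
    moreover have "real n * (F a - F bs) \<le> real n * (F b - F bs) + real n * (K * r)"
      using mult_left_mono[OF Fb, of "real n"] n by (simp add: algebra_simps)
    ultimately show ?thesis by linarith
  next
    case False
    have "cnt \<omega> n b \<le> cnt \<omega> n a" by (rule cnt_mono) (rule a)
    moreover have "real n * (F bs - F a) - (cnt \<omega> n bs - cnt \<omega> n a) \<le> real n * (2 * sqrt (K * \<bar>b - bs\<bar> * r) + (2 * K + 1) * r)"
      using dev' False by (simp add: max_absorb1 min_absorb2 abs_le_iff)
    moreover have "real n * (F a - F bs) \<le> real n * (F b - F bs) + real n * (K * r)"
      using mult_left_mono[OF Fb, of "real n"] n by (simp add: algebra_simps)
    ultimately show ?thesis by (simp add: algebra_simps)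
  qed
  then have "cnt \<omega> n b - cnt \<omega> n bs \<le> real n * ((F b - F bs) + (2 * sqrt (K * \<bar>b - bs\<bar> * r) + (3 * K + 1) * r))"
    by (simp add: algebra_simps)
  then have "(cnt \<omega> n b - cnt \<omega> n bs) / real n \<le> (F b - F bs) + (2 * sqrt (K * \<bar>b - bs\<bar> * r) + (3 * K + 1) * r)"
    using n by (simp add: pos_divide_le_eq mult.commute)
  then show ?thesis by (simp add: r_def)
qed

lemma good_value:
  assumes "\<omega> \<notin> bad n" "2 \<le> n"
  shows "v < ucb \<gamma> \<omega> n" "ucb \<gamma> \<omega> n \<le> v + 2 * width \<gamma> \<omega> n" "wins \<gamma> \<omega> n \<noteq> {}"
proof -
  have "\<omega> \<notin> off_support" using assms(1) by (simp add: bad_def)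
  then have "snd (\<omega> 1) \<in> {0..1}" unfolding off_support_def by blast
  \<comment> \<open>The initial bid 1 always wins on the support, so the empirical mean never
    divides by zero.\<close>
  then have "1 \<in> wins \<gamma> \<omega> n" using assms(2) by (simp add: wins_def ucbid_1)
  then show ne: "wins \<gamma> \<omega> n \<noteq> {}" by auto
  define k where "k = card (wins \<gamma> \<omega> n)"
  have fin: "finite (wins \<gamma> \<omega> n)" by (simp add: wins_def)
  have k1: "1 \<le> k" unfolding k_def using ne fin by (simp add: Suc_le_eq card_gt_0_iff)
  have "k \<le> card {1..n}" unfolding k_def by (intro card_mono) (auto simp: wins_def)
  then have kn: "k \<in> {1..n}" using k1 by simp
  define D where "D = (\<Sum>s\<in>wins \<gamma> \<omega> n. fst (\<omega> s) - v)"
  define w where "w = width \<gamma> \<omega> n"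
  have ln: "0 < ln (real n)" using assms(2) by simp
  have w_eq: "w = sqrt (\<gamma> * ln (real n) / (2 * real k))" by (simp add: w_def width_def k_def)
  have w: "0 < w" "2 * real k * w\<^sup>2 = \<gamma> * ln (real n)" unfolding w_eq using gamma ln k1 by auto
  have lt: "\<sigma> * D < real k * w" if "\<sigma> \<in> {1, -1}" for \<sigma>
  proof -
    \<comment> \<open>The union over \<open>k\<close> is used at the realised number of wins, where
      the penalty \<open>2 * k * w^2\<close> equals \<open>\<gamma> * ln n\<close>.\<close>
    have "\<omega> \<notin> bad_value n k \<sigma>" using assms(1) kn that by (auto simp: bad_def)
    then have "4 * w * (\<sigma> * D) - real k * (4 * w)\<^sup>2 / 8 < \<gamma> * ln (real n)"
      unfolding bad_value_def Let_def w_eq[symmetric] by (simp add: D_def k_def not_le)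
    moreover have "real k * (4 * w)\<^sup>2 / 8 = 2 * real k * w\<^sup>2" by (simp add: power2_eq_square)
    ultimately have "4 * w * (\<sigma> * D) < 4 * w * (real k * w)"
      using w(2) by (simp add: power2_eq_square algebra_simps)
    then show ?thesis using w(1) by simp
  qed
  have "(\<Sum>s\<in>wins \<gamma> \<omega> n. fst (\<omega> s)) / real k = v + D / real k"
    using k1 by (simp add: D_def sum_subtractf k_def[symmetric] field_simps)
  then have c: "ucb \<gamma> \<omega> n = v + D / real k + w" by (simp add: ucb_def k_def w_def)
  have "D / real k < w" "- (D / real k) < w"
    using lt[of 1] lt[of "-1"] k1 by (auto simp: field_simps)
  then show "v < ucb \<gamma> \<omega> n" "ucb \<gamma> \<omega> n \<le> v + 2 * width \<gamma> \<omega> n" unfolding c w_def[symmetric] by auto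
qed

text \<open>An identity up to the slack in the hypothesis. The terms are the bias of the index times
  an increment of \<open>F\<close>, the increment of the estimation error, and the error at the
  fixed point times the displacement; each gets smaller as \<open>B\<close> approaches
  \<open>b\<close>.\<close>

lemma gap_decomposition:
  fixes B b :: real
  assumes "(c - b) * G b \<le> (c - B) * G B"
  shows "U b - U B \<le> (c - v) * (F B - F b) + (c - B) * ((G B - G b) - (F B - F b)) + (b - B) * (G b - F b)"
  using assms by (simp add: util_def algebra_simps)

text \<open>\<open>3 * sqrt (rate n) < F bs\<close> guarantees sample values up to
  \<open>bs\<close>, and \<open>bs \<le> v < c\<close>; so \<open>bs\<close> is an admissible
  comparison point with positive empirical objective.\<close>

lemma bid_optimal:
  assumes "\<omega> \<notin> bad n" "2 \<le> n" "3 * sqrt (rate n) < F bs"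
  defines "B \<equiv> ucbid \<gamma> \<omega> (Suc n)" and "c \<equiv> ucb \<gamma> \<omega> n"
  shows "B \<in> {0..1}" "B < c" "(c - bs) * (cnt \<omega> n bs / real n) \<le> (c - B) * (cnt \<omega> n B / real n)"
proof -
  interpret e: empirical_objective "{1..n}" "\<lambda>s. snd (\<omega> s)" c
    by standard (use assms in auto)
  have n: "0 < real n" using assms by simp
  have cnt: "e.kp b = cnt \<omega> n b" for b unfolding e.kp_def cnt_def ..
  have gp: "e.gp b = (c - b) * (cnt \<omega> n b / real n)" for b unfolding e.gp_def cnt by simp
  have B: "B = e.top_point" unfolding B_def c_def using assms(2) by (subst ucbid_Suc) auto
  have "\<omega> \<notin> off_support" using assms(1) by (simp add: bad_def)
  then have m: "0 \<le> snd (\<omega> s)" if "s \<in> {1..n}" for s unfolding off_support_def by auto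
  have "0 < cnt \<omega> n bs / real n" using good_count_bstar[OF assms(1,2)] assms(3) by linarith
  then have pos: "0 < e.kp bs" unfolding cnt using n by (simp add: zero_less_divide_iff)
  have "bs < c" using good_value(1)[OF assms(1,2)] bstar_le bstar_pos by (simp add: c_def)
  note opt = e.top_point_optimal[OF m bstar_less_1 this pos]
  have *: "e.top_point < c" "e.gp bs \<le> e.gp e.top_point"
    using opt(2) opt(3) bstar_less_1 by auto
  show "B \<in> {0..1}" unfolding B_def by (rule ucbid_mem) simp
  show "B < c" using * B by simp
  show "(c - bs) * (cnt \<omega> n bs / real n) \<le> (c - B) * (cnt \<omega> n B / real n)" using *(2) unfolding gp B .
qed

text \<open>Below \<open>bs\<close> the confidence width plays no role: the optimality inequality survives replacing
  the index by the smaller value \<open>v\<close>. This bounds the bids, hence the number of wins, from below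
  before anything is known about the width.\<close>
lemma gap_left:
  assumes "\<omega> \<notin> bad n" "2 \<le> n" "3 * sqrt (rate n) < F bs"
  defines "B \<equiv> ucbid \<gamma> \<omega> (Suc n)"
  assumes "B < bs"
  shows "U bs - U B \<le> (3 * K + 3) * (sqrt (\<bar>B - bs\<bar> * rate n) + rate n)"
proof -
  define c where "c = ucb \<gamma> \<omega> n"
  define r where "r = rate n"
  define x where "x = \<bar>B - bs\<bar>"
  define G where "G = (\<lambda>b. cnt \<omega> n b / real n)"
  have r: "0 < r" using rate_bounds assms(2) by (auto simp: r_def)
  note opt = bid_optimal[OF assms(1-3), folded B_def c_def]
  have x: "0 \<le> x" "x \<le> 1" using opt(1) bstar_mem by (auto simp: x_def)
  have Gm: "G B \<le> G bs" unfolding G_def using assms(5) cnt_mono[of B bs] by (intro divide_right_mono) auto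
  have "(c - bs) * G bs \<le> (c - B) * G B" using opt(3) by (simp add: G_def)
  moreover have "0 \<le> (c - v) * (G bs - G B)"
    using Gm good_value(1)[OF assms(1,2)] by (simp add: c_def)
  ultimately have "(v - bs) * G bs \<le> (v - B) * G B" by (simp add: algebra_simps)
  from gap_decomposition[of v bs G B, OF this]
  have gap: "U bs - U B \<le> (v - B) * ((G B - G bs) - (F B - F bs)) + (bs - B) * (G bs - F bs)" by simp
  have loc: "(G B - G bs) - (F B - F bs) \<le> 2 * sqrt (K * x * r) + (3 * K + 1) * r"
    using good_count_local[OF assms(1,2) opt(1)] by (simp add: G_def x_def r_def diff_divide_distrib)
  \<comment> \<open>With \<open>v\<close> instead of the index, the factor of the increment is at
    most 1 whatever the width.\<close>
  have vB: "0 \<le> v - B" "v - B \<le> 1" using bstar_le bstar_pos assms(5) v opt(1) by auto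
  have pos: "0 \<le> 2 * sqrt (K * x * r) + (3 * K + 1) * r" using K(1) x r by simp
  have "(v - B) * ((G B - G bs) - (F B - F bs)) \<le> (v - B) * (2 * sqrt (K * x * r) + (3 * K + 1) * r)"
    using loc vB by (intro mult_left_mono)
  also have "\<dots> \<le> 1 * (2 * sqrt (K * x * r) + (3 * K + 1) * r)"
    using vB pos by (intro mult_right_mono)
  also have "sqrt (K * x * r) \<le> K * sqrt (x * r)"
  proof -
    have "sqrt K \<le> K" using K(1) by (intro real_le_lsqrt) (auto simp: power2_eq_square)
    then show ?thesis using x r by (simp add: real_sqrt_mult mult.assoc mult_right_mono)
  qed
  finally have t1: "(v - B) * ((G B - G bs) - (F B - F bs)) \<le> 2 * (K * sqrt (x * r)) + (3 * K + 1) * r" by simp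
  have "(bs - B) * (G bs - F bs) \<le> x * (3 * sqrt r)"
    using good_count_bstar[OF assms(1,2)] assms(5) x by (simp add: x_def G_def r_def mult_left_mono)
  also have "\<dots> \<le> sqrt x * (3 * sqrt r)"
    using x r by (intro mult_right_mono real_le_rsqrt) (auto simp: power2_eq_square mult_left_le)
  also have "\<dots> = 3 * sqrt (x * r)" by (simp add: real_sqrt_mult)
  finally have t2: "(bs - B) * (G bs - F bs) \<le> 3 * sqrt (x * r)" .
  have sr: "0 \<le> sqrt (x * r)" using x r by simp
  have "2 * (K * sqrt (x * r)) + (3 * K + 1) * r + 3 * sqrt (x * r) = (2 * K + 3) * sqrt (x * r) + (3 * K + 1) * r"
    by (simp add: algebra_simps)
  also have "\<dots> \<le> (3 * K + 3) * sqrt (x * r) + (3 * K + 3) * r"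
    using K(1) sr r by (intro add_mono mult_right_mono) auto
  finally show ?thesis using gap t1 t2 by (simp add: x_def r_def algebra_simps)
qed

text \<open>Above \<open>bs\<close> the bias term remains: the index exceeds \<open>v\<close> by at
  most twice the width, and \<open>F\<close> grows by at most \<open>K * x\<close>. With at least
  \<open>\<rho> * n\<close> wins the squared width is at most
  \<open>\<gamma> / (4 * \<rho>) * r\<close>, which is the origin of \<open>E\<close>; then
  \<open>x * sqrt r \<le> sqrt (x * r)\<close> because \<open>x \<le> 1\<close>.\<close>

lemma gap_right:
  assumes "\<omega> \<notin> bad n" "2 \<le> n" "3 * sqrt (rate n) < F bs"
  defines "B \<equiv> ucbid \<gamma> \<omega> (Suc n)"
  assumes "bs \<le> B" and \<rho>: "0 < \<rho>" "\<rho> * real n \<le> real (card (wins \<gamma> \<omega> n))"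
  defines "E \<equiv> sqrt (\<gamma> / (4 * \<rho>))"
  shows "U bs - U B \<le> ((1 + 2 * E) * (3 * K + 1) + 2 * E * K + 3) * (sqrt (\<bar>B - bs\<bar> * rate n) + rate n)"
proof -
  define c where "c = ucb \<gamma> \<omega> n"
  define r where "r = rate n"
  define x where "x = \<bar>B - bs\<bar>"
  define G where "G = (\<lambda>b. cnt \<omega> n b / real n)"
  have n: "0 < real n" using assms(2) by simp
  have r: "0 < r" "r \<le> 1" using rate_bounds assms(2) by (auto simp: r_def)
  have E: "0 \<le> E" using gamma \<rho> by (simp add: E_def)
  note opt = bid_optimal[OF assms(1-3), folded B_def c_def]
  have x: "0 \<le> x" "x \<le> 1" "x = B - bs" using opt(1) bstar_mem assms(5) by (auto simp: x_def)
  have w: "width \<gamma> \<omega> n \<le> E * sqrt r"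
  proof -
    have "0 < real (card (wins \<gamma> \<omega> n))" using \<rho> n by (intro less_le_trans[OF _ \<rho>(2)] mult_pos_pos)
    then
    have "\<gamma> * ln (real n) / (2 * real (card (wins \<gamma> \<omega> n))) \<le> \<gamma> * ln (real n) / (2 * (\<rho> * real n))"
      using gamma \<rho> n assms(2) by (intro divide_left_mono) auto
    also have "\<dots> = \<gamma> / (4 * \<rho>) * r" using n \<rho> by (simp add: r_def rate_def)
    finally show ?thesis unfolding width_def E_def real_sqrt_mult[symmetric] by (rule real_sqrt_le_mono)
  qed
  have sr1: "sqrt r \<le> 1" "0 \<le> sqrt r" using r by auto
  have cv: "0 \<le> c - v" "c - v \<le> 2 * E * sqrt r"
    using good_value[OF assms(1,2)] w by (auto simp: c_def)
  have cB: "0 \<le> c - B" "c - B \<le> 1 + 2 * E"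
  proof -
    show "0 \<le> c - B" using opt(2) by simp
    have "2 * E * sqrt r \<le> 2 * E * 1" using E sr1 by (intro mult_left_mono) auto
    then show "c - B \<le> 1 + 2 * E" using cv v opt(1) by simp
  qed
  have "(c - bs) * G bs \<le> (c - B) * G B" using opt(3) by (simp add: G_def)
  from gap_decomposition[of c bs G B, OF this]
  have gap: "U bs - U B \<le> (c - v) * (F B - F bs) + (c - B) * ((G B - G bs) - (F B - F bs)) + (bs - B) * (G bs - F bs)" .
  have xs: "x * sqrt r \<le> sqrt (x * r)"
  proof -
    have "x \<le> sqrt x" using x by (intro real_le_rsqrt) (auto simp: power2_eq_square mult_left_le)
    then show ?thesis using sr1 by (simp add: real_sqrt_mult mult_right_mono)
  qed
  have loc: "(G B - G bs) - (F B - F bs) \<le> 2 * sqrt (K * x * r) + (3 * K + 1) * r"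
    using good_count_local[OF assms(1,2) opt(1)] by (simp add: G_def x_def r_def diff_divide_distrib)
  have pos: "0 \<le> 2 * sqrt (K * x * r) + (3 * K + 1) * r" using K(1) x r by simp
  have "(c - B) * ((G B - G bs) - (F B - F bs)) \<le> (c - B) * (2 * sqrt (K * x * r) + (3 * K + 1) * r)"
    using loc cB by (intro mult_left_mono)
  also have "\<dots> \<le> (1 + 2 * E) * (2 * sqrt (K * x * r) + (3 * K + 1) * r)"
    using cB pos by (intro mult_right_mono)
  also have "\<dots> \<le> (1 + 2 * E) * (2 * (K * sqrt (x * r)) + (3 * K + 1) * r)"
  proof -
    have "sqrt K \<le> K" using K(1) by (intro real_le_lsqrt) (auto simp: power2_eq_square)
    then have "sqrt (K * x * r) \<le> K * sqrt (x * r)"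
      using x r by (simp add: real_sqrt_mult mult.assoc mult_right_mono)
    then show ?thesis using E by (intro mult_left_mono) auto
  qed
  finally have t1: "(c - B) * ((G B - G bs) - (F B - F bs)) \<le> (1 + 2 * E) * (2 * (K * sqrt (x * r)) + (3 * K + 1) * r)" .
  have "(bs - B) * (G bs - F bs) = x * (F bs - G bs)" unfolding x(3) by (simp add: algebra_simps)
  also have "\<dots> \<le> x * (3 * sqrt r)"
    using good_count_bstar[OF assms(1,2)] x by (intro mult_left_mono) (auto simp: G_def r_def)
  finally have t2: "(bs - B) * (G bs - F bs) \<le> 3 * sqrt (x * r)" using xs by simp
  have "(c - v) * (F B - F bs) \<le> (2 * E * sqrt r) * (K * x)"
    using cv K(2)[of bs B] bstar_mem opt(1) assms(5) F_mono x E sr1 by (intro mult_mono) (auto simp: mono_def)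
  also have "\<dots> = 2 * E * K * (x * sqrt r)" by simp
  also have "\<dots> \<le> 2 * E * K * sqrt (x * r)" using xs E K(1) by (intro mult_left_mono) auto
  finally have t3: "(c - v) * (F B - F bs) \<le> 2 * E * K * sqrt (x * r)" .
  have sr: "0 \<le> sqrt (x * r)" using x r by simp
  have "2 * E * K * sqrt (x * r) + (1 + 2 * E) * (2 * (K * sqrt (x * r)) + (3 * K + 1) * r) + 3 * sqrt (x * r)
    = ((1 + 2 * E) * (2 * K) + 2 * E * K + 3) * sqrt (x * r) + ((1 + 2 * E) * (3 * K + 1)) * r"
    by (simp add: algebra_simps)
  also have "\<dots> \<le> ((1 + 2 * E) * (3 * K + 1) + 2 * E * K + 3) * sqrt (x * r) + ((1 + 2 * E) * (3 * K + 1) + 2 * E * K + 3) * r"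
    using K(1) E sr r by (intro add_mono mult_right_mono mult_left_mono) auto
  finally show ?thesis using gap t1 t2 t3 by (simp add: x_def r_def distrib_left)
qed

text \<open>A bid below half of \<open>bs\<close> would have a gap of at least
  \<open>\<kappa> * (bs / 2)^2\<close>, whereas \<open>gap_left\<close> allows only order
  \<open>sqrt (rate n)\<close>.\<close>

lemma bid_ge_half_bstar:
  assumes "\<omega> \<notin> bad n" "2 \<le> n" "3 * sqrt (rate n) < F bs"
    and small: "bs = 0 \<or> (3 * K + 3) * (2 * sqrt (rate n)) < \<kappa> * (bs / 2)\<^sup>2"
  shows "bs / 2 \<le> ucbid \<gamma> \<omega> (Suc n)"
proof (rule ccontr)
  define B where "B = ucbid \<gamma> \<omega> (Suc n)"
  have B: "B \<in> {0..1}" unfolding B_def by (rule ucbid_mem) simp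
  assume "\<not> bs / 2 \<le> ucbid \<gamma> \<omega> (Suc n)"
  then have lt: "B < bs / 2" by (simp add: B_def)
  then have bs: "0 < bs" "B < bs" using B by auto
  have r: "0 < rate n" "rate n \<le> 1" using rate_bounds assms(2) by auto
  have "\<kappa> * (bs / 2)\<^sup>2 \<le> \<kappa> * (bs - B)\<^sup>2"
    using kappa(1) bs lt by (intro mult_left_mono power_mono) auto
  also have "\<dots> \<le> U bs - U B" using kappa(2)[OF B] by (simp add: power2_commute)
  also have "\<dots> \<le> (3 * K + 3) * (sqrt (\<bar>B - bs\<bar> * rate n) + rate n)"
    using gap_left[OF assms(1-3)] bs by (simp add: B_def)
  also have "\<dots> \<le> (3 * K + 3) * (sqrt (1 * rate n) + sqrt (rate n))"
  proof (intro mult_left_mono add_mono real_sqrt_le_mono mult_right_mono)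
    show "\<bar>B - bs\<bar> \<le> 1" using B bstar_mem by auto
    show "rate n \<le> sqrt (rate n)"
      using r by (intro real_le_rsqrt) (auto simp: power2_eq_square intro: mult_left_le)
  qed (use K(1) r in auto)
  finally show False using small bs by simp
qed

section \<open>Expected regret\<close>

text \<open>A bid of at least \<open>bs / 2\<close> wins with at least this probability. It is
  positive even for \<open>bs = 0\<close>, where \<open>bstar_pos\<close> says that the law has an
  atom at 0.\<close>

definition win_prob :: real where "win_prob = F (bs / 2)"

lemma win_prob_pos: "0 < win_prob"
proof (cases "bs = 0")
  case True
  then show ?thesis using bstar_pos by (simp add: win_prob_def)
next
  case False
  then show ?thesis unfolding win_prob_def using bstar_mem by (intro F_pos) auto
qed

lemma eventually_rate_small: "0 < d \<Longrightarrow> eventually (\<lambda>n. sqrt (rate n) < d) sequentially"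
  using tendsto_real_sqrt[OF rate_tendsto_0] by (auto intro: order_tendstoD)

lemma eventually_bid_ge_half_bstar:
  "\<exists>n0\<ge>2. \<forall>n\<ge>n0. 3 * sqrt (rate n) < F bs \<and> (\<forall>\<omega>. \<omega> \<notin> bad n \<longrightarrow> bs / 2 \<le> ucbid \<gamma> \<omega> (Suc n))"
proof -
  have "eventually (\<lambda>n. bs = 0 \<or> sqrt (rate n) < \<kappa> * (bs / 2)\<^sup>2 / (6 * K + 6)) sequentially"
  proof (cases "bs = 0")
    case False
    then have "0 < \<kappa> * (bs / 2)\<^sup>2 / (6 * K + 6)" using kappa(1) K(1) by simp
    from eventually_rate_small[OF this] show ?thesis by eventually_elim simp
  qed simp
  moreover have "eventually (\<lambda>n. sqrt (rate n) < F bs / 3) sequentially"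
    using bstar_pos by (intro eventually_rate_small) simp
  moreover have "eventually (\<lambda>n. 2 \<le> n) sequentially" by (rule eventually_ge_at_top)
  ultimately have "eventually (\<lambda>n. 3 * sqrt (rate n) < F bs \<and> (\<forall>\<omega>. \<omega> \<notin> bad n \<longrightarrow> bs / 2 \<le> ucbid \<gamma> \<omega> (Suc n))) sequentially"
  proof eventually_elim
    case (elim n)
    have "bs = 0 \<or> (3 * K + 3) * (2 * sqrt (rate n)) < \<kappa> * (bs / 2)\<^sup>2"
      using elim(1) K(1) by (simp add: field_simps)
    then show ?case using elim bid_ge_half_bstar by auto
  qed
  then obtain m where "\<forall>n\<ge>m. 3 * sqrt (rate n) < F bs \<and> (\<forall>\<omega>. \<omega> \<notin> bad n \<longrightarrow> bs / 2 \<le> ucbid \<gamma> \<omega> (Suc n))"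
    by (auto simp: eventually_sequentially)
  then show ?thesis by (intro exI[of _ "max m 2"]) auto
qed

text \<open>The events \<open>bad j\<close> have probability of order \<open>1 / j\<close>, which is too large for a union bound over
  rounds; only the number of rounds in which they occur is controlled, by Markov's inequality.\<close>
definition many_bad :: "nat \<Rightarrow> nat \<Rightarrow> (nat \<Rightarrow> real \<times> real) set" where
  "many_bad n0 n = {\<omega>. real n * win_prob / 4 \<le> real (card {j\<in>{n0..<n}. \<omega> \<in> bad j})}"

lemma many_bad_event: "many_bad n0 n \<in> P.events"
proof -
  have "{\<omega>\<in>space \<Omega>. real n * win_prob / 4 \<le> (\<Sum>j\<in>{n0..<n}. if \<omega> \<in> bad j then 1 else 0)} \<in> P.events" by measurable
  then show ?thesis unfolding many_bad_def real_card_eq_sum[OF finite_atLeastLessThan]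
    by (simp only: space_path UNIV_I simp_thms)
qed

text \<open>Markov's inequality for the expected number of bad rounds. Relaxing \<open>1 / j\<close>
  to \<open>j powr (-2/3)\<close> reuses \<open>sum_powr_le\<close>, and dividing by a multiple of
  \<open>n\<close> leaves exactly the order that can be afforded.\<close>

lemma prob_many_bad:
  assumes "2 \<le> n0" "0 < n"
  shows "P.prob (many_bad n0 n) \<le> 72 / win_prob * real n powr (-2/3)"
proof -
  let ?X = "\<lambda>\<omega>. \<Sum>j\<in>{n0..<n}. indicator (bad j) \<omega> :: real"
  have n: "0 < real n" using assms by simp
  have X: "real (card {j\<in>{n0..<n}. \<omega> \<in> bad j}) = ?X \<omega>" for \<omega>
    unfolding real_card_eq_sum[OF finite_atLeastLessThan] by (intro sum.cong) (auto simp: indicator_def)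
  have int: "integrable \<Omega> ?X" by (intro Bochner_Integration.integrable_sum) (auto simp: P.emeasure_eq_measure)
  have "P.prob (bad j) \<le> 6 * real j powr (-2/3)" if "j \<in> {n0..<n}" for j
  proof -
    have j: "2 \<le> j" using that assms by simp
    have "real j powr (-1) \<le> real j powr (-2/3)" using j by (intro powr_mono) auto
    then show ?thesis using prob_bad[OF j] j by (simp add: powr_minus_divide)
  qed
  then have "(\<Sum>j\<in>{n0..<n}. P.prob (bad j)) \<le> (\<Sum>j\<in>{n0..<n}. 6 * real j powr (-2/3))"
    by (rule sum_mono)
  also have "\<dots> \<le> (\<Sum>j\<in>{1..n}. 6 * real j powr (-2/3))"
    using assms by (intro sum_mono2) auto
  also have "\<dots> \<le> 6 * (3 * real n powr (1/3))"
    unfolding sum_distrib_left[symmetric] by (intro mult_left_mono sum_powr_le) auto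
  finally have EX: "P.expectation ?X \<le> 18 * real n powr (1/3)"
    by (subst Bochner_Integration.integral_sum) (auto simp: P.emeasure_eq_measure)
  have "P.prob (many_bad n0 n) = P.prob {\<omega>\<in>space \<Omega>. real n * win_prob / 4 \<le> ?X \<omega>}"
    unfolding many_bad_def X by simp
  also have "\<dots> \<le> P.expectation ?X / (real n * win_prob / 4)"
    using n win_prob_pos int by (intro integral_Markov_inequality_measure[where A="{}"]) (auto intro!: sum_nonneg)
  also have "\<dots> \<le> 18 * real n powr (1/3) / (real n * win_prob / 4)"
    using EX n win_prob_pos by (intro divide_right_mono) auto
  also have "\<dots> = 72 / win_prob * (real n powr (1/3) / real n powr 1)"
    using n win_prob_pos by (simp add: field_simps)
  also have "real n powr (1/3) / real n powr 1 = real n powr (-2/3)"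
    by (subst powr_diff[symmetric]) simp
  finally show ?thesis .
qed

text \<open>About \<open>win_prob * n\<close> rounds have \<open>M\<close> below
  \<open>bs / 2\<close>. A quarter of this number is given up to each of sampling error, the first
  \<open>n0\<close> rounds and rounds with a bad past; the last quarter consists of wins.\<close>

lemma wins_linear:
  assumes n0: "\<And>j. n0 \<le> j \<Longrightarrow> \<omega> \<notin> bad j \<Longrightarrow> bs / 2 \<le> ucbid \<gamma> \<omega> (Suc j)"
    and "\<omega> \<notin> bad_count n {..bs / 2}" "\<omega> \<notin> many_bad n0 n" "2 \<le> n"
    and r: "2 * sqrt (win_prob * rate n) + rate n \<le> win_prob / 4" and n0n: "real n0 \<le> win_prob / 4 * real n"
  shows "win_prob / 4 * real n \<le> real (card (wins \<gamma> \<omega> n))"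
proof -
  let ?J = "{j\<in>{n0..<n}. \<omega> \<in> bad j}"
  \<comment> \<open>The shift by \<open>Suc\<close> arises because \<open>bad j\<close> governs the
    bid of round \<open>Suc j\<close>.\<close>
  have "{s\<in>{1..n}. snd (\<omega> s) \<le> bs / 2} \<subseteq> wins \<gamma> \<omega> n \<union> ({1..n0} \<union> Suc ` ?J)"
  proof
    fix s assume s: "s \<in> {s\<in>{1..n}. snd (\<omega> s) \<le> bs / 2}"
    then obtain j where j: "s = Suc j" by (cases s) auto
    show "s \<in> wins \<gamma> \<omega> n \<union> ({1..n0} \<union> Suc ` ?J)"
    proof (cases "j < n0")
      case False
      show ?thesis
      proof (cases "\<omega> \<in> bad j")
        case True
        then have "j \<in> ?J" using False s j by auto
        then show ?thesis using j by blast
      next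
        case good: False
        then show ?thesis using n0[of j] False s j by (auto simp: wins_def)
      qed
    qed (use s j in auto)
  qed
  then have "card {s\<in>{1..n}. snd (\<omega> s) \<le> bs / 2} \<le> card (wins \<gamma> \<omega> n \<union> ({1..n0} \<union> Suc ` ?J))"
    by (intro card_mono) (auto simp: wins_def)
  also have "\<dots> \<le> card (wins \<gamma> \<omega> n) + (card {1..n0} + card (Suc ` ?J))"
    by (intro order_trans[OF card_Un_le] add_mono card_Un_le) auto
  also have "card (Suc ` ?J) = card ?J" by (intro card_image) auto
  finally have "cnt \<omega> n (bs / 2) \<le> real (card (wins \<gamma> \<omega> n)) + real n0 + real (card ?J)"
    unfolding cnt_def by simp
  moreover have "real (card ?J) < win_prob / 4 * real n" using assms(3) by (simp add: many_bad_def mult.commute)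
  moreover have "real n * win_prob - real n * (win_prob / 4) \<le> cnt \<omega> n (bs / 2)"
    using good_count[OF assms(2,4)] mult_left_mono[OF r, of "real n"]
    by (simp add: cnt_def win_prob_def cdf_def abs_le_iff)
  ultimately show ?thesis using n0n by (simp add: algebra_simps)
qed

lemma measurable_U_bid [measurable]:
  assumes "0 < t" shows "(\<lambda>\<omega>. U (ucbid \<gamma> \<omega> t)) \<in> borel_measurable \<Omega>"
proof -
  have [measurable]: "F \<in> borel_measurable borel" by (rule borel_measurable_mono[OF F_mono])
  have [measurable]: "(\<lambda>\<omega>. ucbid \<gamma> \<omega> t) \<in> borel_measurable \<Omega>" using assms by (rule measurable_bid)
  show ?thesis unfolding util_def by measurable
qed

lemma integrable_U_bid:
  assumes "0 < t" shows "integrable \<Omega> (\<lambda>\<omega>. U (ucbid \<gamma> \<omega> t))"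
  using assms U_abs_le_1 ucbid_mem
  by (intro P.integrable_const_bound[where B=1] measurable_U_bid) auto

lemma gap_le_rate:
  assumes "\<omega> \<notin> bad n" "2 \<le> n" "3 * sqrt (rate n) < F bs"
    and \<rho>: "0 < \<rho>" "\<rho> * real n \<le> real (card (wins \<gamma> \<omega> n))"
  defines "E \<equiv> sqrt (\<gamma> / (4 * \<rho>))"
  defines "A \<equiv> (1 + 2 * E) * (3 * K + 1) + 2 * E * K + 3"
  shows "U bs - U (ucbid \<gamma> \<omega> (Suc n)) \<le> A * (2 + (2 * A / \<kappa>)\<^sup>2) * rate n powr (2/3)"
proof -
  define B where "B = ucbid \<gamma> \<omega> (Suc n)"
  have B: "B \<in> {0..1}" unfolding B_def by (rule ucbid_mem) simp
  have r: "0 < rate n" "rate n \<le> 1" using rate_bounds assms(2) by auto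
  have E: "0 \<le> E" using gamma \<rho> by (simp add: E_def)
  have "0 \<le> E * (3 * K + 1)" "0 \<le> E * K" using E K(1) by auto
  then have A: "3 * K + 3 \<le> A" by (simp add: A_def algebra_simps)
  have "U bs - U B \<le> A * (sqrt (\<bar>B - bs\<bar> * rate n) + rate n)"
  proof (cases "B < bs")
    case True
    have "U bs - U B \<le> (3 * K + 3) * (sqrt (\<bar>B - bs\<bar> * rate n) + rate n)"
      using gap_left[OF assms(1-3)] True by (simp add: B_def)
    also have "\<dots> \<le> A * (sqrt (\<bar>B - bs\<bar> * rate n) + rate n)" using A r by (intro mult_right_mono) auto
    finally show ?thesis .
  next
    case False
    then show ?thesis using gap_right[OF assms(1-3) _ \<rho>] by (simp add: B_def A_def E_def)
  qed
  moreover have "\<kappa> * \<bar>B - bs\<bar>\<^sup>2 \<le> U bs - U B" using kappa(2)[OF B] by simp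
  ultimately show ?thesis unfolding B_def[symmetric]
    using kappa(1) A K(1) r by (intro self_bounding_cubic) auto
qed

lemma expected_gap_le:
  "\<exists>C n1. 0 \<le> C \<and> 2 \<le> n1 \<and> (\<forall>n\<ge>n1. U bs - P.expectation (\<lambda>\<omega>. U (ucbid \<gamma> \<omega> (Suc n)))
     \<le> C * (1 + ln (real n)) * real n powr (-2/3))"
proof -
  obtain n0 where n0: "2 \<le> n0" "\<And>n. n0 \<le> n \<Longrightarrow> 3 * sqrt (rate n) < F bs"
    "\<And>n \<omega>. n0 \<le> n \<Longrightarrow> \<omega> \<notin> bad n \<Longrightarrow> bs / 2 \<le> ucbid \<gamma> \<omega> (Suc n)"
    using eventually_bid_ge_half_bstar by blast
  define \<rho> where "\<rho> = win_prob / 4"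
  have \<rho>: "0 < \<rho>" using win_prob_pos by (simp add: \<rho>_def)
  define E where "E = sqrt (\<gamma> / (4 * \<rho>))"
  define A where "A = (1 + 2 * E) * (3 * K + 1) + 2 * E * K + 3"
  define A' where "A' = A * (2 + (2 * A / \<kappa>)\<^sup>2)"
  have "0 \<le> E" using gamma \<rho> by (simp add: E_def)
  then have "0 \<le> A" using K(1) by (simp add: A_def)
  then have A': "0 \<le> A'" by (simp add: A'_def)
  \<comment> \<open>One twelfth, because the sampling error is at most
    \<open>3 * sqrt (rate n)\<close> and its budget is a quarter of \<open>win_prob\<close>.\<close>
  have "eventually (\<lambda>n. sqrt (rate n) < win_prob / 12) sequentially"
    using win_prob_pos by (intro eventually_rate_small) simp
  moreover have "eventually (\<lambda>n. nat \<lceil>real n0 / \<rho>\<rceil> \<le> n) sequentially" by (rule eventually_ge_at_top)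
  moreover have "eventually (\<lambda>n. n0 \<le> n) sequentially" by (rule eventually_ge_at_top)
  ultimately have "eventually (\<lambda>n. U bs - P.expectation (\<lambda>\<omega>. U (ucbid \<gamma> \<omega> (Suc n)))
     \<le> (2 * A' + 16 + 144 / win_prob) * (1 + ln (real n)) * real n powr (-2/3)) sequentially"
  proof eventually_elim
    case (elim n)
    have n: "2 \<le> n" "0 < real n" "1 \<le> real n" using elim(3) n0(1) by auto
    have r: "0 < rate n" "rate n \<le> 1" using rate_bounds n by auto
    have q1: "win_prob \<le> 1" by (simp add: win_prob_def F_le_1)
    have "sqrt (win_prob * rate n) \<le> sqrt (rate n)"
      using q1 r win_prob_pos by (intro real_sqrt_le_mono mult_left_le_one_le) auto
    moreover have "rate n \<le> sqrt (rate n)"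
      using r by (intro real_le_rsqrt) (auto simp: power2_eq_square intro: mult_left_le)
    ultimately have r4: "2 * sqrt (win_prob * rate n) + rate n \<le> win_prob / 4" using elim(1) by linarith
    have "real n0 / \<rho> \<le> real n" using elim(2) by linarith
    then have n0n: "real n0 \<le> win_prob / 4 * real n" using \<rho> by (simp add: field_simps \<rho>_def)
    let ?Z = "bad n \<union> bad_count n {..bs / 2} \<union> many_bad n0 n"
    let ?l = "real n powr (-2/3)"
    have Z: "?Z \<in> P.events" by (intro sets.Un bad_event bad_count_event many_bad_event) auto
    \<comment> \<open>On the exceptional set the gap is bounded by 2, as \<open>U\<close> takes
      values in [-1,1].\<close>
    have pt: "U bs - U (ucbid \<gamma> \<omega> (Suc n)) \<le> A' * rate n powr (2/3) + 2 * indicator ?Z \<omega>" for \<omega>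
    proof (cases "\<omega> \<in> ?Z")
      case True
      have "\<bar>U bs\<bar> \<le> 1" "\<bar>U (ucbid \<gamma> \<omega> (Suc n))\<bar> \<le> 1"
        using U_abs_le_1 bstar_mem ucbid_mem[of "Suc n"] by auto
      then show ?thesis using True A' by (simp add: indicator_def) (smt (verit) mult_nonneg_nonneg powr_ge_zero)
    next
      case False
      then have "win_prob / 4 * real n \<le> real (card (wins \<gamma> \<omega> n))"
        using n0(3) n r4 n0n by (intro wins_linear[of n0]) auto
      then have "U bs - U (ucbid \<gamma> \<omega> (Suc n)) \<le> A' * rate n powr (2/3)"
        unfolding A'_def A_def E_def using False n0(2)[OF elim(3)] n(1) \<rho>
        by (intro gap_le_rate) (auto simp: \<rho>_def)
      then show ?thesis using False by simp
    qed
    have "U bs - P.expectation (\<lambda>\<omega>. U (ucbid \<gamma> \<omega> (Suc n))) = P.expectation (\<lambda>\<omega>. U bs - U (ucbid \<gamma> \<omega> (Suc n)))"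
      using integrable_U_bid[of "Suc n"] P.prob_space by simp
    also have "\<dots> \<le> P.expectation (\<lambda>\<omega>. A' * rate n powr (2/3) + 2 * indicator ?Z \<omega>)"
      using integrable_U_bid[of "Suc n"] Z pt
      by (intro integral_mono Bochner_Integration.integrable_diff Bochner_Integration.integrable_add integrable_mult_right)
        (auto simp: P.emeasure_eq_measure)
    also have "\<dots> = A' * rate n powr (2/3) + 2 * P.prob ?Z"
      using Z P.prob_space by (subst Bochner_Integration.integral_add) (auto simp: P.emeasure_eq_measure)
    also have "P.prob ?Z \<le> P.prob (bad n) + P.prob (bad_count n {..bs / 2}) + P.prob (many_bad n0 n)"
      by (intro order_trans[OF measure_Un_le] add_mono measure_Un_le sets.Un bad_event bad_count_event many_bad_event order_refl) auto
    also have "\<dots> \<le> 6 * ?l + 2 * ?l + 72 / win_prob * ?l"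
    proof (intro add_mono)
      have inv: "1 / real n \<le> ?l"
        using powr_mono[of "-1" "-2/3" "real n"] n by (simp add: powr_minus_divide)
      then show "P.prob (bad n) \<le> 6 * ?l" using prob_bad[OF n(1)] by simp
      have "1 / (real n)\<^sup>2 \<le> 1 / real n" using n by (simp add: field_simps power2_eq_square)
      then show "P.prob (bad_count n {..bs / 2}) \<le> 2 * ?l"
        using prob_bad_count[OF n(1), of "{..bs / 2}"] inv by simp
      show "P.prob (many_bad n0 n) \<le> 72 / win_prob * ?l" using n n0(1) by (intro prob_many_bad) auto
    qed
    finally have main: "U bs - P.expectation (\<lambda>\<omega>. U (ucbid \<gamma> \<omega> (Suc n))) \<le> A' * rate n powr (2/3) + 2 * (6 * ?l + 2 * ?l + 72 / win_prob * ?l)"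
      by simp
    have ln: "0 \<le> ln (real n)" using n by simp
    have "rate n powr (2/3) = (2 * ln (real n)) powr (2/3) * ?l"
      using ln n by (simp add: rate_def powr_divide powr_minus_divide)
    \<comment> \<open>Bounding the power 2/3 of the logarithm by a linear expression is wasteful but
      harmless: any power of the logarithm fits into \<open>T powr \<epsilon>\<close>.\<close>
    also have "\<dots> \<le> (2 * (1 + ln (real n))) * ?l"
      using powr_two_thirds_le[of "2 * ln (real n)"] ln by (intro mult_right_mono) auto
    finally have "A' * rate n powr (2/3) \<le> A' * ((2 * (1 + ln (real n))) * ?l)" using A' by (intro mult_left_mono)
    moreover have "2 * (6 * ?l + 2 * ?l + 72 / win_prob * ?l) = (16 + 144 / win_prob) * ?l" by (simp add: algebra_simps)
    moreover have "(16 + 144 / win_prob) * ?l \<le> (16 + 144 / win_prob) * ((1 + ln (real n)) * ?l)"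
      using win_prob_pos ln by (intro mult_left_mono mult_right_mono) (auto intro: mult_left_mono simp: algebra_simps)
    ultimately show ?case using main by (simp add: algebra_simps add_divide_distrib)
  qed
  then obtain n1 where "\<forall>n\<ge>n1. U bs - P.expectation (\<lambda>\<omega>. U (ucbid \<gamma> \<omega> (Suc n)))
     \<le> (2 * A' + 16 + 144 / win_prob) * (1 + ln (real n)) * real n powr (-2/3)"
    by (auto simp: eventually_sequentially)
  moreover have "0 \<le> 2 * A' + 16 + 144 / win_prob" using A' win_prob_pos by simp
  ultimately show ?thesis
    by (intro exI[of _ "2 * A' + 16 + 144 / win_prob"] exI[of _ "max n1 2"]) auto
qed

section \<open>Summation over the rounds\<close>

lemma regret_eq: "regret PV PM \<gamma> T = (\<Sum>k<T. U bs - P.expectation (\<lambda>\<omega>. U (ucbid \<gamma> \<omega> (Suc k))))"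
proof -
  have "(\<Sum>t=1..T. P.expectation (\<lambda>\<omega>. U (ucbid \<gamma> \<omega> t))) = (\<Sum>k<T. P.expectation (\<lambda>\<omega>. U (ucbid \<gamma> \<omega> (Suc k))))"
    using sum.atLeast1_atMost_eq[of "\<lambda>t. P.expectation (\<lambda>\<omega>. U (ucbid \<gamma> \<omega> t))" T] by simp
  then show ?thesis unfolding regret_def by (simp add: U_bstar[symmetric] sum_subtractf)
qed

text \<open>The first \<open>n1\<close> rounds cost at most 2 each. In later rounds the logarithm is
  raised to its value at \<open>T\<close>, taken out of the sum, and bounded by
  \<open>T powr \<epsilon> / \<epsilon>\<close>.\<close>

theorem regret_bigo:
  assumes "0 < \<epsilon>"
  shows "(\<lambda>T. regret PV PM \<gamma> T) \<in> O(\<lambda>T. real T powr (1/3 + \<epsilon>))"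
proof -
  obtain C n1 where C: "0 \<le> C" "2 \<le> n1"
    "\<And>n. n1 \<le> n \<Longrightarrow> U bs - P.expectation (\<lambda>\<omega>. U (ucbid \<gamma> \<omega> (Suc n))) \<le> C * (1 + ln (real n)) * real n powr (-2/3)"
    using expected_gap_le by blast
  define e where "e = (\<lambda>k. U bs - P.expectation (\<lambda>\<omega>. U (ucbid \<gamma> \<omega> (Suc k))))"
  have e0: "0 \<le> e k" "e k \<le> 2" for k
  proof -
    have le: "U (ucbid \<gamma> \<omega> (Suc k)) \<le> U bs" "- 1 \<le> U (ucbid \<gamma> \<omega> (Suc k))" for \<omega>
      using U_le[OF ucbid_mem, of "Suc k"] U_abs_le_1[OF ucbid_mem, of "Suc k" \<gamma> \<omega>] by auto
    have "P.expectation (\<lambda>\<omega>. U (ucbid \<gamma> \<omega> (Suc k))) \<le> U bs"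
      using le by (intro P.integral_le_const integrable_U_bid) auto
    moreover have "- 1 \<le> P.expectation (\<lambda>\<omega>. U (ucbid \<gamma> \<omega> (Suc k)))"
      using le by (intro P.integral_ge_const integrable_U_bid) auto
    moreover have "U bs \<le> 1" using U_abs_le_1[OF bstar_mem] by simp
    ultimately show "0 \<le> e k" "e k \<le> 2" by (auto simp: e_def)
  qed
  have "norm (regret PV PM \<gamma> T) \<le> (2 * real n1 + 3 * C * (1 + 1 / \<epsilon>)) * norm (real T powr (1/3 + \<epsilon>))"
    if T: "1 \<le> T" for T
  proof -
    let ?L = "C * (1 + ln (real T))"
    have T1: "1 \<le> real T" using T by simp
    have L: "0 \<le> ?L" using C T by simp
    have "e k \<le> (if k < n1 then 2 else 0) + ?L * real k powr (-2/3)" if "k < T" for k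
    proof (cases "k < n1")
      case True
      have "0 \<le> ?L * real k powr (-2/3)" using L by simp
      then show ?thesis using True e0[of k] by simp
    next
      case False
      have "ln (real k) \<le> ln (real T)" using that False C(2) by simp
      then have "C * (1 + ln (real k)) * real k powr (-2/3) \<le> ?L * real k powr (-2/3)"
        using C(1) by (intro mult_right_mono mult_left_mono) auto
      then show ?thesis using C(3)[of k] False by (simp add: e_def)
    qed
    then have "(\<Sum>k<T. e k) \<le> (\<Sum>k<T. (if k < n1 then 2 else 0) + ?L * real k powr (-2/3))"
      by (intro sum_mono) auto
    also have "\<dots> = (\<Sum>k<T. if k < n1 then 2 else 0) + ?L * (\<Sum>k<T. real k powr (-2/3))"
      by (simp add: sum.distrib sum_distrib_left)
    also have "(\<Sum>k<T. if k < n1 then 2 else 0) \<le> 2 * real n1"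
    proof -
      have "(\<Sum>k<T. if k < n1 then 2 else 0 :: real) = 2 * real (card ({..<T} \<inter> {k. k < n1}))"
        by (simp add: sum.If_cases)
      also have "card ({..<T} \<inter> {k. k < n1}) \<le> card {..<n1}" by (intro card_mono) auto
      finally show ?thesis by simp
    qed
    also have "(\<Sum>k<T. real k powr (-2/3)) \<le> 3 * real T powr (1/3)"
    proof -
      \<comment> \<open>The index 0 is harmless because \<open>0 powr (-2/3)\<close> is 0.\<close>
      have "(\<Sum>k<T. real k powr (-2/3)) \<le> (\<Sum>k\<in>insert 0 {1..T}. real k powr (-2/3))"
        by (intro sum_mono2) auto
      also have "\<dots> = (\<Sum>k\<in>{1..T}. real k powr (-2/3))" by simp
      finally show ?thesis using sum_powr_le[of T] by simp
    qed
    finally have "(\<Sum>k<T. e k) \<le> 2 * real n1 + ?L * (3 * real T powr (1/3))"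
      using L by (simp add: mult_left_mono)
    also have "?L \<le> C * ((1 + 1 / \<epsilon>) * real T powr \<epsilon>)"
    proof -
      have "ln (real T) \<le> real T powr \<epsilon> / \<epsilon>" using T1 assms by (rule ln_powr_bound)
      moreover have "1 \<le> real T powr \<epsilon>" using T1 assms by (intro ge_one_powr_ge_zero) auto
      ultimately show ?thesis using C(1) by (intro mult_left_mono) (auto simp: algebra_simps)
    qed
    also have "C * ((1 + 1 / \<epsilon>) * real T powr \<epsilon>) * (3 * real T powr (1/3)) = 3 * C * (1 + 1 / \<epsilon>) * real T powr (1/3 + \<epsilon>)"
      by (simp add: powr_add mult_ac)
    also have "2 * real n1 \<le> 2 * real n1 * real T powr (1/3 + \<epsilon>)"
      using T1 assms by (auto simp: mult_le_cancel_left1 intro!: ge_one_powr_ge_zero)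
    finally have "(\<Sum>k<T. e k) \<le> (2 * real n1 + 3 * C * (1 + 1 / \<epsilon>)) * real T powr (1/3 + \<epsilon>)"
      by (simp add: algebra_simps mult_right_mono)
    moreover have "0 \<le> (\<Sum>k<T. e k)" using e0 by (intro sum_nonneg) auto
    ultimately show ?thesis by (simp add: regret_eq e_def)
  qed
  then show ?thesis
    by (intro bigoI[where c="2 * real n1 + 3 * C * (1 + 1 / \<epsilon>)"]) (auto simp: eventually_sequentially)
qed

end

theorem theorem6:
  fixes PV PM :: "real measure" and f :: "real \<Rightarrow> real"
    and \<Delta> c_f C_f lam \<gamma> \<epsilon> :: real
  assumes V_dist: "prob_space PV" "sets PV = sets borel" "measure PV {0..1} = 1"
    and M_dist: "prob_space PM" "sets PM = sets borel" "measure PM {0..1} = 1"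
    and A1_C1: "continuous_on {0..1} f"
      "\<forall>b\<in>{0..1}. (cdf PM has_real_derivative f b) (at b within {0..1})"
    and A1_logconc: "strict_antimono_on {0<..<1} (\<lambda>b. f b / cdf PM b)"
    and A2: "\<Delta> > 0" "c_f > 0"
      "\<forall>b\<in>{bstar (mean_val PV) (cdf PM) - \<Delta> .. bstar (mean_val PV) (cdf PM) + \<Delta>} \<inter> {0..1}.
          c_f < f b \<and> f b < C_f"
      "\<forall>b\<in>{bstar (mean_val PV) (cdf PM) .. bstar (mean_val PV) (cdf PM) + \<Delta>} \<inter> {0..1}.
          \<exists>D. ((\<lambda>x. x + cdf PM x / f x) has_real_derivative D)
                (at b within {bstar (mean_val PV) (cdf PM) .. bstar (mean_val PV) (cdf PM) + \<Delta>} \<inter> {0..1})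
              \<and> D \<le> lam"
    and pos: "cdf PM (bstar (mean_val PV) (cdf PM)) > 0"
    and \<gamma>: "\<gamma> > 2" and \<epsilon>: "\<epsilon> > 0"
  shows "(\<lambda>T. regret PV PM \<gamma> T) \<in> O(\<lambda>T. real T powr (1/3 + \<epsilon>))"
proof -
  interpret auction PV PM \<gamma>
    by (intro auction.intro real_distribution.intro real_distribution_axioms.intro auction_axioms.intro V_dist M_dist \<gamma>)
  have lc: "log_concave_cdf (cdf PM) f (mean_val PV)"
  proof
    show "mono (cdf PM)" by (auto intro!: monoI M.cdf_nondecreasing)
    have "measure PM {0..1} \<le> measure PM {..1}" by (intro M.finite_measure_mono) auto
    then show "cdf PM 1 = 1" using M_dist(3) M.prob_le_1[of "{..1}"] by (simp add: cdf_def)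
  qed (use A1_C1 A1_logconc v_mem M.cdf_nonneg M.cdf_bounded_prob in auto)
  then interpret log_concave_cdf "cdf PM" f "mean_val PV" .
  obtain \<kappa> where "0 < \<kappa>" "\<forall>b\<in>{0..1}. \<kappa> * (b - bs)\<^sup>2 \<le> U bs - U b"
    using U_gap_quadratic[OF A2(2,1)] A2(3) by auto
  moreover obtain K where "1 \<le> K" "\<forall>x y. 0 \<le> x \<longrightarrow> x \<le> y \<longrightarrow> y \<le> 1 \<longrightarrow> cdf PM y - cdf PM x \<le> K * (y - x)"
    using F_lipschitz by blast
  ultimately interpret ucbid_regret PV PM \<gamma> f \<kappa> K
    by unfold_locales (use lc pos in auto)
  show ?thesis by (rule regret_bigo[OF \<epsilon>])
qed

end
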